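(* As $n\to\infty$, $$G(n)\sim\frac{\pi}{\sqrt{6n}}\,p(n).$$ Equivalently, $$G(n)\sim\frac{\pi}{12\sqrt2\,n^{3/2}}\exp\left(\pi\sqrt{\frac{2n}{3}}\right).$$ Moreover, $$\frac{G(n)}{H(n)}\sim\frac{\pi}{\sqrt{6n}}.$$
   Context: $p(n)$ denotes the number of (unrestricted) partitions of the positive integer $n$, $H(n):=p(n)-n$, and for $n\ge3$ the gap length is $G(n):=H(n+1)-H(n)-1$, equivalently $G(n)=p(n+1)-p(n)-2$. Here $a(n)\sim b(n)$ means $a(n)/b(n)\to1$ as $n\to\infty$. *)

theory Defs
  imports "HOL-Analysis.Analysis" "HOL-Library.Multiset" "HOL-Library.Landau_Symbols"
begin

definition partitions_of :: "nat \<Rightarrow> nat multiset set" where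
  "partitions_of n = {M. 0 \<notin># M \<and> sum_mset M = n}"

definition partition_number :: "nat \<Rightarrow> nat" where
  "partition_number n = card (partitions_of n)"

text \<open>\<^term>\<open>card\<close> returns 0 on infinite sets, so finiteness is needed for it to be the actual count.\<close>

lemma finite_partitions_of: "finite (partitions_of n)"
proof -
  have "partitions_of n \<subseteq> mset ` {xs. set xs \<subseteq> {..n} \<and> length xs \<le> n}"
  proof
    fix M assume "M \<in> partitions_of n"
    then have M: "0 \<notin># M" "sum_mset M = n"
      by (auto simp: partitions_of_def)
    have size: "size N \<le> sum_mset N" if "0 \<notin># N" for N :: "nat multiset"
      using that by (induction N) auto
    have elem: "x \<le> n" if "x \<in># M" for x
      using M(2) multi_member_split[OF that] by auto
    obtain xs where xs: "mset xs = M"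
      using ex_mset by blast
    have "set xs \<subseteq> {..n}"
      using elem xs by auto
    moreover have "length xs \<le> n"
      using size[OF M(1)] M(2) xs by auto
    ultimately show "M \<in> mset ` {xs. set xs \<subseteq> {..n} \<and> length xs \<le> n}"
      using xs by blast
  qed
  then show ?thesis
    by (rule finite_subset) (simp add: finite_lists_length_le)
qed

text \<open>The paper's \<open>H(n) = p(n) - n\<close> and \<open>G(n) = H(n+1) - H(n) - 1\<close>. They are integer-valued so that
  the subtractions do not truncate. The paper uses \<open>G(n)\<close> only for \<open>n \<ge> 3\<close>; the
  definition makes sense for every \<open>n\<close>.\<close>

definition partition_H :: "nat \<Rightarrow> int" where
  "partition_H n = int (partition_number n) - int n"

definition partition_G :: "nat \<Rightarrow> int" where
  "partition_G n = partition_H (n + 1) - partition_H n - 1"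

lemma partition_G_eq:
  "partition_G n = int (partition_number (n + 1)) - int (partition_number n) - 2"
  by (simp add: partition_G_def partition_H_def)

end

theory Submission
  imports Defs "HOL-Probability.Probability" "HOL-Real_Asymp.Real_Asymp"
begin

text \<open>
  Saddle point method without modular forms. With \<open>z = exp (-\<tau>)\<close> and \<open>\<tau> = t + \<i>y\<close>, the generating function
  \<open>\<Sum>n. p(n) z^n\<close> is \<open>exp (L \<tau>)\<close> where \<open>L \<tau> = \<Sum>m\<ge>1. 1 / (m (exp (m\<tau>) - 1))\<close>, and \<open>2\<pi> p(n)\<close> is the integral of
  \<open>exp (L \<tau> + n\<tau>)\<close> over \<open>\<bar>y\<bar> \<le> \<pi>\<close>. An additional factor \<open>exp \<tau> - 1\<close>, which is about \<open>t\<close> at the saddle point,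
  turns \<open>p(n)\<close> into \<open>p(n+1) - p(n)\<close>; this is where the factor \<open>\<pi> / sqrt (6n)\<close> comes from.

  Take \<open>t = \<pi> / sqrt (6n)\<close> and rescale \<open>y = t\<^bsup>3/2\<^esup> u\<close>. Then \<open>L \<tau> - L t + n\<i>y\<close> tends to \<open>- \<pi>\<^sup>2 u\<^sup>2 / 6\<close>, because
  \<open>L \<tau> - \<pi>\<^sup>2 / (6\<tau>)\<close> barely varies in the vertical direction, and dominated convergence applies because the
  \<open>m = 1\<close> term of \<open>L\<close> alone forces enough decay in \<open>u\<close>. The real asymptotics
  \<open>L t = \<pi>\<^sup>2 / (6t) + ln t / 2 - ln (2\<pi>) / 2 + o(1)\<close> follows by comparing \<open>\<Sum>k. ln (1 - exp (-kt))\<close> with an integral by the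
  trapezoidal rule: as \<open>t \<rightarrow> 0\<close>, the errors tend to those of \<open>ln\<close>, whose sum is given by Stirling's formula.
\<close>

section \<open>The generating function of the partition numbers\<close>

text \<open>The asymptotics of \<open>p(n+1)\<close> and \<open>p(n)\<close> cannot simply be
  subtracted: the difference is smaller than \<open>p(n)\<close> by a factor of order
  \<open>n powr (-1/2)\<close> and would be lost in the error \<open>o(p(n))\<close>. The factor
  \<open>exp tau - 1\<close> is therefore kept inside the integral, and one convergence theorem with
  a weight serves both \<open>p(n)\<close> (weight 1) and the difference (weight
  \<open>(exp tau - 1) / t\<close>, which tends to 1). The point \<open>t = pi / sqrt (6n)\<close>
  minimises \<open>pi^2 / (6t) + n t\<close>; the second derivative there is
  \<open>pi^2 / (3 t^3)\<close>, whence the scale \<open>t^(3/2)\<close> and the Gaussian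
  \<open>exp (- pi^2 u^2 / 6)\<close>. Off the real axis only the difference
  \<open>L tau - L t\<close> enters, so the logarithm and the constant in the expansion of
  \<open>L\<close> have to be found for real \<open>t\<close> alone. A single bound for
  \<open>Re (L tau - L t)\<close> on the whole segment \<open>|y| <= pi\<close> replaces the
  division into major and minor arcs.\<close>

definition partitions_upto :: "nat \<Rightarrow> nat \<Rightarrow> nat multiset set" where
  "partitions_upto K n = {M \<in> partitions_of n. set_mset M \<subseteq> {..K}}"

lemma finite_partitions_upto [simp]: "finite (partitions_upto K n)"
  unfolding partitions_upto_def using finite_partitions_of by simp

lemma card_partitions_upto_0: "card (partitions_upto 0 n) = (if n = 0 then 1 else 0)"
proof -
  have "M = {#} \<and> n = 0" if "M \<in> partitions_upto 0 n" for M
  proof -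
    have M: "0 \<notin># M" "sum_mset M = n" "set_mset M \<subseteq> {..0}"
      using that unfolding partitions_upto_def partitions_of_def by auto
    hence "set_mset M = {}" by blast
    with M(2) show ?thesis by simp
  qed
  moreover have "{#} \<in> partitions_upto 0 0"
    by (simp add: partitions_upto_def partitions_of_def)
  ultimately have "partitions_upto 0 n = (if n = 0 then {{#}} else {})" by auto
  thus ?thesis by simp
qed

lemma member_le_sum_mset:
  fixes M :: "nat multiset"
  shows "x \<in># M \<Longrightarrow> x \<le> sum_mset M"
  by (metis le_add1 multi_member_split sum_mset.add_mset)

text \<open>A partition either avoids the part \<open>Suc K\<close> or contains it; in the second
  case removing one copy is a bijection onto the partitions of \<open>n - Suc K\<close> with the
  same bound on the parts. On generating functions this is multiplication by
  \<open>1 / (1 - z ^ Suc K)\<close>.\<close>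

lemma card_partitions_upto_Suc:
  "card (partitions_upto (Suc K) n) =
     card (partitions_upto K n) + (if Suc K \<le> n then card (partitions_upto (Suc K) (n - Suc K)) else 0)"
proof -
  define A where "A = {M \<in> partitions_upto (Suc K) n. Suc K \<in># M}"
  have split: "partitions_upto (Suc K) n = partitions_upto K n \<union> A"
    by (auto simp: A_def partitions_upto_def atMost_Suc)
  have disj: "partitions_upto K n \<inter> A = {}"
    by (auto simp: A_def partitions_upto_def)
  have "card (partitions_upto (Suc K) n) = card (partitions_upto K n) + card A"
    unfolding split by (rule card_Un_disjoint) (use disj in \<open>auto simp: A_def\<close>)
  also have "card A = (if Suc K \<le> n then card (partitions_upto (Suc K) (n - Suc K)) else 0)"
  proof (cases "Suc K \<le> n")
    case True
    have "A = add_mset (Suc K) ` partitions_upto (Suc K) (n - Suc K)"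
    proof (intro equalityI subsetI)
      fix M assume "M \<in> A"
      then obtain N where "M = add_mset (Suc K) N"
        unfolding A_def by (auto dest: multi_member_split)
      thus "M \<in> add_mset (Suc K) ` partitions_upto (Suc K) (n - Suc K)"
        using \<open>M \<in> A\<close> by (auto simp: A_def partitions_upto_def partitions_of_def)
    next
      fix M assume "M \<in> add_mset (Suc K) ` partitions_upto (Suc K) (n - Suc K)"
      thus "M \<in> A"
        using True by (auto simp: A_def partitions_upto_def partitions_of_def)
    qed
    hence "card A = card (partitions_upto (Suc K) (n - Suc K))"
      by (simp add: card_image inj_on_def)
    thus ?thesis using True by simp
  next
    case False
    have "M \<notin> A" for M
      using False member_le_sum_mset[of "Suc K" M]
      unfolding A_def partitions_upto_def partitions_of_def by blast
    hence "A = {}" by blast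
    thus ?thesis using False by simp
  qed
  finally show ?thesis .
qed

lemma card_partitions_upto_le: "card (partitions_upto K n) \<le> partition_number n"
  unfolding partition_number_def partitions_upto_def
  by (rule card_mono) (auto simp: finite_partitions_of)

lemma card_partitions_upto_eq:
  assumes "n \<le> K"
  shows   "card (partitions_upto K n) = partition_number n"
proof -
  have "x \<le> K" if "x \<in># M" "sum_mset M = n" for x :: nat and M
    using that assms member_le_sum_mset[of x M] by simp
  hence "partitions_upto K n = partitions_of n"
    by (auto simp: partitions_upto_def partitions_of_def)
  thus ?thesis by (simp add: partition_number_def)
qed

text \<open>The partial sums \<open>S\<close> satisfy \<open>S <= B + r ^ k * S\<close>, because the
  reindexed shifted sum only reaches indices up to \<open>N - k\<close>; so
  \<open>B / (1 - r ^ k)\<close> bounds them. Convergence has to be known before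
  \<open>sums_geometric_recurrence\<close> can solve \<open>C = B + z ^ k * C\<close> for the sum
  \<open>C\<close>.\<close>

lemma summable_geometric_recurrence:
  fixes b c :: "nat \<Rightarrow> real"
  assumes b: "summable (\<lambda>n. b n * r ^ n)"
  assumes nonneg: "\<And>n. b n \<ge> 0" "\<And>n. c n \<ge> 0" and r: "0 \<le> r" "r < 1" and "k > 0"
  assumes rec: "\<And>n. c n = b n + (if k \<le> n then c (n - k) else 0)"
  shows   "summable (\<lambda>n. c n * r ^ n)"
proof (rule bounded_imp_summable)
  show "0 \<le> c n * r ^ n" for n using nonneg r by simp
  fix N
  define S where "S = (\<Sum>n\<le>N. c n * r ^ n)"
  define B where "B = (\<Sum>n. b n * r ^ n)"
  have rk: "r ^ k < 1" using r \<open>k > 0\<close> by (simp add: power_less_one_iff)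
  have "S = (\<Sum>n\<le>N. b n * r ^ n) + (\<Sum>n\<le>N. if k \<le> n then c (n - k) * r ^ n else 0)"
    unfolding S_def sum.distrib[symmetric]
    by (intro sum.cong refl, subst rec) (simp add: algebra_simps)
  also have "(\<Sum>n\<le>N. if k \<le> n then c (n - k) * r ^ n else 0) = (\<Sum>n\<in>{k..N}. c (n - k) * r ^ n)"
    by (intro sum.mono_neutral_cong_right) auto
  also have "\<dots> = (\<Sum>n\<in>(\<lambda>n. n - k) ` {k..N}. c n * r ^ (n + k))"
    by (subst sum.reindex) (auto simp: inj_on_def intro!: sum.cong)
  also have "\<dots> \<le> (\<Sum>n\<le>N. c n * r ^ (n + k))"
    using nonneg r by (intro sum_mono2) auto
  also have "\<dots> = r ^ k * S" by (simp add: S_def sum_distrib_left power_add mult_ac)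
  also have "(\<Sum>n\<le>N. b n * r ^ n) \<le> B"
    unfolding B_def using nonneg r by (intro sum_le_suminf b) auto
  finally have "S * (1 - r ^ k) \<le> B" by (simp add: algebra_simps)
  thus "(\<Sum>n\<le>N. c n * r ^ n) \<le> B / (1 - r ^ k)"
    using rk by (simp add: S_def field_simps)
qed

lemma sums_geometric_recurrence:
  fixes b c :: "nat \<Rightarrow> complex"
  assumes "(\<lambda>n. b n * z ^ n) sums B" and "summable (\<lambda>n. c n * z ^ n)" and zk: "z ^ k \<noteq> 1"
  assumes rec: "\<And>n. c n = b n + (if k \<le> n then c (n - k) else 0)"
  shows   "(\<lambda>n. c n * z ^ n) sums (B / (1 - z ^ k))"
proof -
  define C where "C = (\<Sum>n. c n * z ^ n)"
  have C: "(\<lambda>n. c n * z ^ n) sums C" unfolding C_def using assms(2) by (rule summable_sums)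
  define d where "d = (\<lambda>n. if k \<le> n then c (n - k) * z ^ n else 0)"
  have "(\<lambda>n. d (n + k)) sums (z ^ k * C)"
    using sums_mult[OF C, of "z ^ k"] by (simp add: d_def power_add mult_ac)
  moreover have "(\<Sum>n<k. d n) = 0" by (intro sum.neutral) (auto simp: d_def)
  ultimately have "d sums (z ^ k * C)" using sums_iff_shift[of d k "z ^ k * C"] by simp
  with assms(1) have "(\<lambda>n. b n * z ^ n + d n) sums (B + z ^ k * C)" by (rule sums_add)
  also have "(\<lambda>n. b n * z ^ n + d n) = (\<lambda>n. c n * z ^ n)"
    by (rule ext, subst rec) (simp add: d_def algebra_simps)
  finally have "B + z ^ k * C = C" using C by (rule sums_unique2)
  hence "C = B / (1 - z ^ k)" using zk by (simp add: field_simps)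
  thus ?thesis using C by simp
qed

lemma summable_partitions_upto:
  fixes r :: real
  assumes "0 \<le> r" "r < 1"
  shows   "summable (\<lambda>n. real (card (partitions_upto K n)) * r ^ n)"
proof (induction K)
  case 0
  show ?case by (rule summable_finite[of "{0}"]) (auto simp: card_partitions_upto_0)
next
  case (Suc K)
  show ?case
  proof (rule summable_geometric_recurrence[OF Suc])
    show "real (card (partitions_upto (Suc K) n)) = real (card (partitions_upto K n)) +
            (if Suc K \<le> n then real (card (partitions_upto (Suc K) (n - Suc K))) else 0)" for n
      by (subst card_partitions_upto_Suc) simp
  qed (use assms in auto)
qed

lemma norm_less_one_power_neq_one:
  fixes z :: complex
  assumes "norm z < 1" "k > 0"
  shows   "z ^ k \<noteq> 1"
proof
  assume "z ^ k = 1"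
  hence "norm z ^ k = 1" by (metis norm_one norm_power)
  moreover have "norm z ^ k < 1" using assms by (simp add: power_less_one_iff)
  ultimately show False by simp
qed

lemma partitions_upto_sums:
  fixes z :: complex
  assumes "norm z < 1"
  shows   "(\<lambda>n. of_nat (card (partitions_upto K n)) * z ^ n) sums (\<Prod>k=1..K. 1 / (1 - z ^ k))"
proof (induction K)
  case 0
  show ?case using sums_finite[of "{0}" "\<lambda>n. of_nat (card (partitions_upto 0 n)) * z ^ n"]
    by (simp add: card_partitions_upto_0)
next
  case (Suc K)
  have "summable (\<lambda>n. norm (of_nat (card (partitions_upto (Suc K) n)) * z ^ n))"
    using summable_partitions_upto[of "norm z"] assms by (simp add: norm_mult norm_power)
  hence "summable (\<lambda>n. of_nat (card (partitions_upto (Suc K) n)) * z ^ n)"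
    by (rule summable_norm_cancel)
  have "of_nat (card (partitions_upto (Suc K) n)) = of_nat (card (partitions_upto K n)) +
          (if Suc K \<le> n then of_nat (card (partitions_upto (Suc K) (n - Suc K))) else (0 :: complex))" for n
    by (subst card_partitions_upto_Suc) simp
  from sums_geometric_recurrence[OF Suc \<open>summable (\<lambda>n. of_nat (card (partitions_upto (Suc K) n)) * z ^ n)\<close> _ this]
  show ?case
    using norm_less_one_power_neq_one[OF assms, of "Suc K"] by (simp del: power_Suc)
qed

section \<open>The logarithm of Euler's product as a Lambert series\<close>

definition log_partition_series :: "complex \<Rightarrow> complex" where
  "log_partition_series z = (\<Sum>m. (z ^ Suc m / (1 - z ^ Suc m)) / of_nat (Suc m))"

lemma norm_one_minus_ge:
  fixes z :: complex
  shows "norm (1 - z ^ Suc m) \<ge> 1 - norm z ^ Suc m"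
  using norm_triangle_ineq2[of 1 "z ^ Suc m"] by (simp add: norm_power norm_mult)

lemma norm_log_partition_term:
  fixes z :: complex
  assumes "norm z < 1"
  shows   "norm ((z ^ Suc m / (1 - z ^ Suc m)) / of_nat (Suc m))
             \<le> (norm z ^ Suc m / (1 - norm z ^ Suc m)) / of_nat (Suc m)"
proof -
  have "norm z ^ Suc m < 1" using assms power_less_one_iff[of "norm z" "Suc m"] by simp
  thus ?thesis unfolding norm_divide norm_power norm_of_nat
    by (intro divide_right_mono divide_left_mono frac_le norm_one_minus_ge) auto
qed

lemma summable_log_partition_real:
  fixes r :: real
  assumes "0 \<le> r" "r < 1"
  shows   "summable (\<lambda>m. (r ^ Suc m / (1 - r ^ Suc m)) / of_nat (Suc m))"
proof (rule summable_comparison_test')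
  show "summable (\<lambda>m. r ^ Suc m * (1 / (1 - r)))"
    using assms by (intro summable_mult2 summable_Suc_iff[THEN iffD2] summable_geometric) auto
  fix m :: nat
  have "r ^ Suc m \<le> r" using assms power_Suc_le_self[of r m] by simp
  hence "(r ^ Suc m / (1 - r ^ Suc m)) / of_nat (Suc m) \<le> (r ^ Suc m / (1 - r)) / 1"
    using assms by (intro frac_le divide_nonneg_nonneg) (auto simp del: power_Suc)
  thus "norm ((r ^ Suc m / (1 - r ^ Suc m)) / of_nat (Suc m)) \<le> r ^ Suc m * (1 / (1 - r))"
    using assms \<open>r ^ Suc m \<le> r\<close> by (simp del: power_Suc)
qed

lemma summable_norm_log_partition:
  fixes z :: complex
  assumes "norm z < 1"
  shows   "summable (\<lambda>m. norm ((z ^ Suc m / (1 - z ^ Suc m)) / of_nat (Suc m)))"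
proof (rule summable_comparison_test'[OF summable_log_partition_real[of "norm z"]])
  show "norm (norm ((z ^ Suc m / (1 - z ^ Suc m)) / of_nat (Suc m)))
          \<le> (norm z ^ Suc m / (1 - norm z ^ Suc m)) / of_nat (Suc m)" for m
    unfolding real_norm_def abs_norm_cancel by (rule norm_log_partition_term[OF assms])
qed (use assms in auto)

lemma Ln_one_minus_sums:
  fixes w :: complex
  assumes "norm w < 1"
  shows   "(\<lambda>m. w ^ Suc m / of_nat (Suc m)) sums (- Ln (1 - w))"
proof -
  have "(\<lambda>n. - (w ^ n) / of_nat n) sums Ln (1 - w)"
    using Ln_series'[of "-w"] assms by simp
  hence "(\<lambda>n. w ^ n / of_nat n) sums (- Ln (1 - w))"
    using sums_minus by fastforce
  \<comment> \<open>The term at index 0 is a division by zero, hence 0, so dropping it does not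
    change the sum.\<close>
  thus ?thesis by (subst sums_Suc_iff) simp
qed

text \<open>Interchange \<open>\<Sum>k \<Sum>m z^(km)/m\<close>, the inner sum over \<open>k\<close> being geometric.\<close>

lemma log_partition_tendsto:
  fixes z :: complex
  assumes z: "norm z < 1"
  shows   "(\<lambda>K. \<Sum>k=1..K. - Ln (1 - z ^ k)) \<longlonglongrightarrow> log_partition_series z"
proof -
  define a where "a = (\<lambda>m K. (\<Sum>k=1..K. (z ^ k) ^ Suc m) / of_nat (Suc m))"
  define M where "M = (\<lambda>m. (norm z ^ Suc m / (1 - norm z ^ Suc m)) / of_nat (Suc m))"
  have geom: "(\<Sum>k=1..K. (w ^ k)) = w * (1 - w ^ K) / (1 - w)" if "w \<noteq> 1" for w :: "'b :: field" and K
    using that by (simp add: sum_gp algebra_simps)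
  have pw: "(w ^ k) ^ Suc m = (w ^ Suc m) ^ k" for w :: "'b :: field" and k m
    by (simp only: power_mult [symmetric] mult.commute)
  have Suc_less: "norm z ^ Suc m < 1" for m using z power_less_one_iff[of "norm z" "Suc m"] by simp
  have "((\<lambda>K. \<Sum>m. a m K) \<longlongrightarrow> (\<Sum>m. (z ^ Suc m / (1 - z ^ Suc m)) / of_nat (Suc m))) sequentially"
  proof (rule tannerys_theorem[THEN conjunct2, THEN conjunct2])
    fix m
    have "z ^ Suc m \<noteq> 1" using norm_less_one_power_neq_one[OF z, of "Suc m"] by simp
    hence "a m = (\<lambda>K. z ^ Suc m * (1 - (z ^ Suc m) ^ K) / (1 - z ^ Suc m) / of_nat (Suc m))"
      unfolding a_def pw by (subst geom) auto
    moreover have "(\<lambda>K. (z ^ Suc m) ^ K) \<longlonglongrightarrow> 0"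
      by (rule LIMSEQ_power_zero) (use Suc_less[of m] in \<open>simp add: norm_mult norm_power\<close>)
    hence "(\<lambda>K. z ^ Suc m * (1 - (z ^ Suc m) ^ K) / (1 - z ^ Suc m) / of_nat (Suc m)) \<longlonglongrightarrow>
             z ^ Suc m * (1 - 0) / (1 - z ^ Suc m) / of_nat (Suc m)"
      using \<open>z ^ Suc m \<noteq> 1\<close>
      by (intro tendsto_divide tendsto_mult tendsto_diff tendsto_const) (auto simp del: of_nat_Suc)
    ultimately show "a m \<longlonglongrightarrow> (z ^ Suc m / (1 - z ^ Suc m)) / of_nat (Suc m)" by simp
  next
    have "norm (a m K) \<le> M m" for m K
    proof -
      have "norm (\<Sum>k=1..K. (z ^ k) ^ Suc m) \<le> (\<Sum>k=1..K. (norm z ^ Suc m) ^ k)"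
        by (rule order_trans[OF norm_sum], subst pw) (simp add: norm_power norm_mult)
      also have "\<dots> = norm z ^ Suc m * (1 - (norm z ^ Suc m) ^ K) / (1 - norm z ^ Suc m)"
        by (rule geom) (use Suc_less[of m] in auto)
      also have "\<dots> \<le> norm z ^ Suc m * 1 / (1 - norm z ^ Suc m)"
        using Suc_less[of m] by (intro divide_right_mono mult_left_mono) (auto simp del: power_Suc)
      finally show ?thesis unfolding a_def M_def norm_divide norm_of_nat
        by (intro divide_right_mono) auto
    qed
    thus "\<forall>\<^sub>F (m, K) in at_top \<times>\<^sub>F sequentially. norm (a m K) \<le> M m"
      by (intro always_eventually) auto
  next
    show "summable M"
      unfolding M_def by (rule summable_log_partition_real) (use z in auto)
  qed auto
  also have "(\<lambda>K. \<Sum>m. a m K) = (\<lambda>K. \<Sum>k=1..K. - Ln (1 - z ^ k))"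
  proof
    fix K
    have "(\<lambda>m. \<Sum>k=1..K. (z ^ k) ^ Suc m / of_nat (Suc m)) sums (\<Sum>k=1..K. - Ln (1 - z ^ k))"
      using z by (intro sums_sum Ln_one_minus_sums) (auto simp: norm_power power_less_one_iff)
    thus "(\<Sum>m. a m K) = (\<Sum>k=1..K. - Ln (1 - z ^ k))"
      by (simp add: a_def sums_iff sum_divide_distrib)
  qed
  finally show ?thesis unfolding log_partition_series_def .
qed

text \<open>Applying \<open>exp\<close> to the sum of logarithms makes the branches of
  \<open>Ln\<close> harmless: each factor only uses \<open>exp (Ln w) = w\<close> for nonzero
  \<open>w\<close>.\<close>

lemma prod_partition_tendsto:
  fixes z :: complex
  assumes z: "norm z < 1"
  shows   "(\<lambda>K. \<Prod>k=1..K. 1 / (1 - z ^ k)) \<longlonglongrightarrow> exp (log_partition_series z)"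
proof -
  have "(\<lambda>K. exp (\<Sum>k=1..K. - Ln (1 - z ^ k))) \<longlonglongrightarrow> exp (log_partition_series z)"
    by (intro tendsto_exp log_partition_tendsto z)
  moreover have "exp (\<Sum>k=1..K. - Ln (1 - z ^ k)) = (\<Prod>k=1..K. 1 / (1 - z ^ k))" for K
    unfolding exp_sum[OF finite_atLeastAtMost]
    using norm_less_one_power_neq_one[OF z] by (intro prod.cong) (auto simp: exp_minus divide_inverse)
  ultimately show ?thesis by simp
qed

text \<open>Up to index \<open>N\<close> the coefficients agree with those of the finite product for
  \<open>K = N\<close>, so the partial sum is at most \<open>P N\<close>, and \<open>P\<close> is
  bounded because it converges. The resulting series is the majorant for complex \<open>z\<close> in
  the next lemma.\<close>

lemma summable_partition_number:
  fixes r :: real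
  assumes r: "0 \<le> r" "r < 1"
  shows   "summable (\<lambda>n. real (partition_number n) * r ^ n)"
proof -
  define P where "P = (\<lambda>K. \<Prod>k=1..K. 1 / (1 - r ^ k))"
  have sums: "(\<lambda>n. real (card (partitions_upto K n)) * r ^ n) sums P K" for K
  proof -
    have "(\<lambda>n. of_nat (card (partitions_upto K n)) * complex_of_real r ^ n) sums
            (\<Prod>k=1..K. 1 / (1 - complex_of_real r ^ k))"
      using partitions_upto_sums[of "of_real r" K] r by simp
    also have "(\<Prod>k=1..K. 1 / (1 - complex_of_real r ^ k)) = of_real (P K)"
      by (simp add: P_def)
    also have "(\<lambda>n. of_nat (card (partitions_upto K n)) * complex_of_real r ^ n) =
               (\<lambda>n. of_real (real (card (partitions_upto K n)) * r ^ n))" by simp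
    finally show ?thesis by (simp only: sums_of_real_iff)
  qed
  have "(\<lambda>K. complex_of_real (P K)) \<longlonglongrightarrow> exp (log_partition_series (of_real r))"
    using prod_partition_tendsto[of "of_real r"] r by (simp add: P_def)
  hence "Bseq (\<lambda>K. complex_of_real (P K))" by (intro convergent_imp_Bseq convergentI)
  then obtain B where B: "\<And>K. \<bar>P K\<bar> \<le> B" by (auto simp: Bseq_def)
  show ?thesis
  proof (rule bounded_imp_summable)
    show "0 \<le> real (partition_number n) * r ^ n" for n using r by simp
    fix N
    have "(\<Sum>n\<le>N. real (partition_number n) * r ^ n) = (\<Sum>n\<le>N. real (card (partitions_upto N n)) * r ^ n)"
      by (intro sum.cong) (auto simp: card_partitions_upto_eq)
    also have "\<dots> \<le> P N"
      using sum_le_suminf[OF sums_summable[OF sums[of N]], of "{..N}"] r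
      by (simp add: sums_unique[OF sums[of N]])
    also have "\<dots> \<le> B" using B[of N] by simp
    finally show "(\<Sum>n\<le>N. real (partition_number n) * r ^ n) \<le> B" .
  qed
qed

text \<open>Tannery's theorem in \<open>K\<close>: the coefficient at \<open>n\<close> is constant
  once \<open>K >= n\<close>, and it never exceeds \<open>partition_number n\<close>.\<close>

lemma partition_number_generating_function:
  fixes z :: complex
  assumes z: "norm z < 1"
  shows   "(\<lambda>n. of_nat (partition_number n) * z ^ n) sums exp (log_partition_series z)"
proof -
  define M where "M = (\<lambda>n. real (partition_number n) * norm z ^ n)"
  have M: "summable M" unfolding M_def using z by (intro summable_partition_number) auto
  have "((\<lambda>K. \<Sum>n. of_nat (card (partitions_upto K n)) * z ^ n) \<longlongrightarrow>
           (\<Sum>n. of_nat (partition_number n) * z ^ n)) sequentially"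
  proof (rule tannerys_theorem[THEN conjunct2, THEN conjunct2])
    fix n
    have "\<forall>\<^sub>F K in sequentially. of_nat (card (partitions_upto K n)) * z ^ n = of_nat (partition_number n) * z ^ n"
      using eventually_ge_at_top[of n] by eventually_elim (simp add: card_partitions_upto_eq)
    thus "(\<lambda>K. of_nat (card (partitions_upto K n)) * z ^ n) \<longlonglongrightarrow> of_nat (partition_number n) * z ^ n"
      by (rule tendsto_eventually)
  next
    have "norm (of_nat (card (partitions_upto K n)) * z ^ n) \<le> M n" for n K
      unfolding M_def norm_mult norm_power norm_of_nat
      using card_partitions_upto_le by (intro mult_right_mono) auto
    thus "\<forall>\<^sub>F (n, K) in at_top \<times>\<^sub>F sequentially. norm (of_nat (card (partitions_upto K n)) * z ^ n) \<le> M n"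
      by (intro always_eventually) (auto simp del: norm_mult)
  qed (use M in auto)
  also have "(\<lambda>K. \<Sum>n. of_nat (card (partitions_upto K n)) * z ^ n) = (\<lambda>K. \<Prod>k=1..K. 1 / (1 - z ^ k))"
    using partitions_upto_sums[OF z] by (simp add: sums_iff)
  finally have "(\<Sum>n. of_nat (partition_number n) * z ^ n) = exp (log_partition_series z)"
    using prod_partition_tendsto[OF z] LIMSEQ_unique by blast
  moreover have "summable (\<lambda>n. of_nat (partition_number n) * z ^ n)"
    by (rule summable_comparison_test'[OF M, of 0]) (simp add: M_def norm_mult norm_power)
  ultimately show ?thesis by (simp add: sums_iff)
qed

section \<open>The size of the generating function on the real axis\<close>

lemma tannery:
  fixes a :: "nat \<Rightarrow> 'b \<Rightarrow> 'a :: {real_normed_algebra, banach}"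
  assumes "\<And>k. (a k \<longlongrightarrow> b k) F" and ev: "\<forall>\<^sub>F x in F. \<forall>k. norm (a k x) \<le> M k"
    and "summable M" "F \<noteq> bot"
  shows "summable b" "((\<lambda>x. \<Sum>k. a k x) \<longlongrightarrow> (\<Sum>k. b k)) F"
proof -
  have "\<forall>\<^sub>F (k, x) in at_top \<times>\<^sub>F F. norm (a k x) \<le> M k"
    unfolding eventually_prod_filter case_prod_conv
    by (rule exI[of _ "\<lambda>_. True"], rule exI, intro conjI, simp, rule ev) auto
  from tannerys_theorem[OF assms(1) this assms(3,4)]
  show "summable b" "((\<lambda>x. \<Sum>k. a k x) \<longlongrightarrow> (\<Sum>k. b k)) F"
    using summable_norm_cancel by blast+
qed

text \<open>If \<open>phi x\<close> is the error on \<open>{a..x}\<close>, then \<open>phi\<close>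
  and its derivative vanish at \<open>a\<close>, and the second derivative is
  \<open>(x - a) * q x / 2\<close>; two applications of the mean value inequality finish. This
  yields the constant 1/2 in place of the sharp 1/12; what matters later is the order in
  \<open>b - a\<close>.\<close>

lemma trapezoid_error:
  fixes F f g q :: "real \<Rightarrow> real"
  assumes ab: "a \<le> b"
  assumes F: "\<And>x. a \<le> x \<Longrightarrow> x \<le> b \<Longrightarrow> (F has_real_derivative f x) (at x)"
  assumes f: "\<And>x. a \<le> x \<Longrightarrow> x \<le> b \<Longrightarrow> (f has_real_derivative g x) (at x)"
  assumes g: "\<And>x. a \<le> x \<Longrightarrow> x \<le> b \<Longrightarrow> (g has_real_derivative q x) (at x)"
  assumes M: "\<And>x. a \<le> x \<Longrightarrow> x \<le> b \<Longrightarrow> \<bar>q x\<bar> \<le> M"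
  shows "\<bar>(b - a) * (f a + f b) / 2 - (F b - F a)\<bar> \<le> M * (b - a) ^ 3 / 2"
proof -
  have vanish: "\<bar>h x\<bar> \<le> B * (b - a)"
    if "\<And>x. a \<le> x \<Longrightarrow> x \<le> b \<Longrightarrow> (h has_real_derivative h' x) (at x)"
       "\<And>x. a \<le> x \<Longrightarrow> x \<le> b \<Longrightarrow> \<bar>h' x\<bar> \<le> B" "h a = 0" "a \<le> x" "x \<le> b" for h h' B x
  proof -
    have "norm (h x - h a) \<le> B * norm (x - a)"
      by (rule field_differentiable_bound[of "{a..b}"])
         (use that ab in \<open>auto intro: has_field_derivative_at_within\<close>)
    also have "\<dots> \<le> B * (b - a)"
    proof (rule mult_left_mono)
      show "0 \<le> B" using that(2)[of a] ab by linarith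
    qed (use that in auto)
    finally show ?thesis using that by simp
  qed
  define \<phi> where "\<phi> = (\<lambda>x. (x - a) * (f a + f x) / 2 - (F x - F a))"
  define \<phi>' where "\<phi>' = (\<lambda>x. (f a - f x) / 2 + (x - a) * g x / 2)"
  have M0: "M \<ge> 0" using M[of a] ab by simp
  have \<phi>': "\<bar>\<phi>' x\<bar> \<le> ((b - a) * M / 2) * (b - a)" if "a \<le> x" "x \<le> b" for x
  proof (rule vanish[of \<phi>' "\<lambda>x. (x - a) * q x / 2"])
    fix x assume x: "a \<le> x" "x \<le> b"
    show "(\<phi>' has_real_derivative (x - a) * q x / 2) (at x)"
      unfolding \<phi>'_def using f[OF x] g[OF x]
      by (auto intro!: derivative_eq_intros simp: field_simps)
    show "\<bar>(x - a) * q x / 2\<bar> \<le> (b - a) * M / 2"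
      using x M[OF x] by (auto simp: abs_mult intro!: mult_mono)
  qed (use that in \<open>auto simp: \<phi>'_def\<close>)
  have "\<bar>\<phi> b\<bar> \<le> (((b - a) * M / 2) * (b - a)) * (b - a)"
  proof (rule vanish[of \<phi> \<phi>'])
    fix x assume x: "a \<le> x" "x \<le> b"
    show "(\<phi> has_real_derivative \<phi>' x) (at x)"
      unfolding \<phi>_def \<phi>'_def using f[OF x] F[OF x]
      by (auto intro!: derivative_eq_intros simp: field_simps)
    show "\<bar>\<phi>' x\<bar> \<le> ((b - a) * M / 2) * (b - a)" by (rule \<phi>'[OF x])
  qed (use ab in \<open>auto simp: \<phi>_def\<close>)
  thus ?thesis by (simp add: \<phi>_def power3_eq_cube mult_ac)
qed

section \<open>The function ln (1 - exp (-x)) and its antiderivative\<close>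

definition ln1mexp :: "real \<Rightarrow> real" where
  "ln1mexp x = ln (1 - exp (- x))"

text \<open>Both bounds are instances of \<open>1 + v <= exp v\<close>, at \<open>v = -x\<close> and
  at \<open>v = x\<close>. Together they make \<open>ln\<close> the model for \<open>ln1mexp\<close>
  near 0, with an error of at most \<open>x\<close>.\<close>

lemma ln1mexp_bounds:
  assumes "x > 0"
  shows   "ln x - x \<le> ln1mexp x" "ln1mexp x \<le> ln x"
proof -
  have "1 - exp (-x) \<le> x" using exp_ge_add_one_self[of "-x"] by simp
  moreover have "1 - exp (-x) > 0" using assms by simp
  ultimately show "ln1mexp x \<le> ln x" using assms by (simp add: ln1mexp_def)
  have "x * exp (-x) \<le> 1 - exp (-x)"
    using exp_ge_add_one_self[of x] by (simp add: exp_minus field_simps)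
  hence "ln (x * exp (-x)) \<le> ln (1 - exp (-x))" using assms by simp
  thus "ln x - x \<le> ln1mexp x" using assms by (simp add: ln1mexp_def ln_mult)
qed

lemma has_real_derivative_ln1mexp:
  assumes "x > 0"
  shows   "(ln1mexp has_real_derivative 1 / (exp x - 1)) (at x)"
proof -
  have "1 - exp (-x) > 0" using assms by simp
  thus ?thesis unfolding ln1mexp_def
    by (auto intro!: derivative_eq_intros simp: exp_minus field_simps)
qed

text \<open>This is \<open>r / 2 <= sinh (r / 2)\<close> multiplied by
  \<open>2 * exp (r / 2)\<close>. The function \<open>h\<close> is \<open>2 * (sinh y - y)\<close>,
  with derivative \<open>2 * (cosh y - 1)\<close>.\<close>

lemma exp_minus_one_ge:
  fixes r :: real
  assumes "r \<ge> 0"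
  shows   "r * exp (r / 2) \<le> exp r - 1"
proof -
  define h where "h = (\<lambda>y::real. exp y - exp (-y) - 2 * y)"
  have "h 0 \<le> h (r / 2)"
  proof (rule DERIV_nonneg_imp_nondecreasing[of 0 "r / 2" h])
    fix y :: real
    have "(h has_real_derivative exp y + exp (-y) - 2) (at y)"
      unfolding h_def by (auto intro!: derivative_eq_intros)
    moreover have "exp y + exp (-y) - 2 \<ge> 0"
      using cosh_real_ge_1[of y] by (simp add: cosh_def)
    ultimately show "\<exists>d. (h has_real_derivative d) (at y) \<and> 0 \<le> d" by blast
  qed (use assms in auto)
  hence "r \<le> exp (r / 2) - exp (- r / 2)" by (simp add: h_def)
  hence "r * exp (r / 2) \<le> (exp (r / 2) - exp (- r / 2)) * exp (r / 2)"
    by (intro mult_right_mono) auto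
  thus ?thesis by (simp add: left_diff_distrib flip: exp_add)
qed

text \<open>In absolute value, the second derivative of \<open>ln1mexp\<close> is at most that of
  \<open>ln\<close>. The same inequality controls the complex derivative in
  \<open>bose_derivative_bound_far\<close>.\<close>

lemma exp_div_exp_minus_one_squared_le:
  fixes r :: real
  assumes "r > 0"
  shows   "exp r / (exp r - 1)\<^sup>2 \<le> 1 / r\<^sup>2"
proof -
  have "(r * exp (r / 2))\<^sup>2 \<le> (exp r - 1)\<^sup>2"
    using exp_minus_one_ge[of r] assms by (intro power_mono) auto
  also have "(r * exp (r / 2))\<^sup>2 = r\<^sup>2 * exp r"
    by (simp add: power_mult_distrib flip: exp_double)
  finally show ?thesis using assms by (simp add: field_simps)
qed

lemma inverse_squares_sums_from_0: "(\<lambda>n. 1 / real n ^ 2) sums (pi\<^sup>2 / 6)"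
proof -
  have "(\<lambda>n. 1 / real (Suc n) ^ 2) sums (pi\<^sup>2 / 6)"
    using inverse_squares_sums by (simp add: add_ac)
  thus ?thesis using sums_Suc_iff[of "\<lambda>n. 1 / real n ^ 2" "pi\<^sup>2 / 6"] by simp
qed

text \<open>The dilogarithm \<open>Li_2 (exp (-x))\<close>, an antiderivative of
  \<open>ln1mexp\<close>; the term at \<open>n = 0\<close> vanishes because
  \<open>1 / 0 = 0\<close>. Its limit at 0 is the source of \<open>pi^2 / 6\<close>.\<close>

definition dilog_exp :: "real \<Rightarrow> real" where
  "dilog_exp x = (\<Sum>n. 1 / real n ^ 2 * exp (- x) ^ n)"

lemma has_real_derivative_dilog_exp:
  assumes "x > 0"
  shows   "(dilog_exp has_real_derivative ln1mexp x) (at x)"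
proof -
  define y where "y = exp (-x)"
  have y: "0 < y" "y < 1" using assms by (auto simp: y_def)
  define c where "c = (\<lambda>n. 1 / real n ^ 2)"
  have "summable (\<lambda>n. c n * 1 ^ n)"
    using inverse_power_summable[of 2, where ?'a = real] by (simp add: c_def divide_inverse)
  hence "((\<lambda>z. \<Sum>n. c n * z ^ n) has_real_derivative (\<Sum>n. diffs c n * y ^ n)) (at y)"
    by (rule termdiffs_strong) (use y in auto)
  moreover have "(\<lambda>n. diffs c n * y ^ n) sums (- ln (1 - y) / y)"
  proof -
    have "(\<lambda>n. - (y ^ n) / real n) sums ln (1 - y)" using ln_series'[of "-y"] y by simp
    hence "(\<lambda>n. - (y ^ Suc n) / real (Suc n)) sums ln (1 - y)" by (subst sums_Suc_iff) simp
    from sums_mult[OF this, of "-1 / y"] have "(\<lambda>n. (-1 / y) * (- (y ^ Suc n) / real (Suc n))) sums (- ln (1 - y) / y)"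
      by simp
    also have "(\<lambda>n. (-1 / y) * (- (y ^ Suc n) / real (Suc n))) = (\<lambda>n. diffs c n * y ^ n)"
    proof
      fix n
      have "diffs c n = 1 / real (Suc n)"
        by (simp add: diffs_def c_def power2_eq_square del: of_nat_Suc)
      thus "(-1 / y) * (- (y ^ Suc n) / real (Suc n)) = diffs c n * y ^ n"
        using y by (simp del: of_nat_Suc)
    qed
    finally show ?thesis .
  qed
  ultimately have "((\<lambda>z. \<Sum>n. c n * z ^ n) has_real_derivative (- ln (1 - y) / y)) (at (exp (-x)))"
    by (simp add: sums_iff y_def)
  hence "((\<lambda>x. \<Sum>n. c n * exp (-x) ^ n) has_real_derivative (- ln (1 - y) / y) * (- exp (-x))) (at x)"
    by (rule DERIV_chain2) (auto intro!: derivative_eq_intros)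
  thus ?thesis using y unfolding dilog_exp_def [abs_def] c_def ln1mexp_def by (simp add: y_def)
qed

lemma dilog_exp_at_right_0: "(dilog_exp \<longlongrightarrow> pi\<^sup>2 / 6) (at_right 0)"
proof -
  note s = inverse_squares_sums_from_0
  have "((\<lambda>x. \<Sum>n. 1 / real n ^ 2 * exp (- x) ^ n) \<longlongrightarrow> (\<Sum>n. 1 / real n ^ 2)) (at_right 0)"
  proof (rule tannery)
    show "((\<lambda>x. 1 / real n ^ 2 * exp (- x) ^ n) \<longlongrightarrow> 1 / real n ^ 2) (at_right 0)" for n
    proof -
      have "((\<lambda>x. 1 / real n ^ 2 * exp (- x) ^ n) \<longlongrightarrow> 1 / real n ^ 2 * exp (- 0) ^ n) (at_right 0)"
        by (intro tendsto_mult tendsto_const tendsto_power tendsto_exp tendsto_minus tendsto_ident_at)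
      thus ?thesis by simp
    qed
    show "\<forall>\<^sub>F x::real in at_right 0. \<forall>n. norm (1 / real n ^ 2 * exp (- x) ^ n) \<le> 1 / real n ^ 2"
      using eventually_at_right_less[of 0]
      by eventually_elim (auto simp: mult_le_one power_le_one intro!: divide_right_mono)
  qed (use s in \<open>auto simp: sums_iff\<close>)
  thus ?thesis using s unfolding dilog_exp_def [abs_def] by (simp add: sums_unique[OF s, symmetric])
qed

lemma dilog_exp_at_top: "(dilog_exp \<longlongrightarrow> 0) at_top"
proof -
  note s = inverse_squares_sums_from_0
  have "((\<lambda>x. \<Sum>n. 1 / real n ^ 2 * exp (- x) ^ n) \<longlongrightarrow> (\<Sum>n. 0)) at_top"
  proof (rule tannery)
    have "((\<lambda>x::real. exp (-x)) \<longlongrightarrow> 0) at_top"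
      by real_asymp
    hence "((\<lambda>x. 1 / real n ^ 2 * exp (- x) ^ n) \<longlongrightarrow> 1 / real n ^ 2 * 0 ^ n) at_top" for n
      by (intro tendsto_intros)
    moreover have "1 / real n ^ 2 * 0 ^ n = 0" for n by (cases n) auto
    ultimately show "((\<lambda>x. 1 / real n ^ 2 * exp (- x) ^ n) \<longlongrightarrow> 0) at_top" for n by metis
    show "\<forall>\<^sub>F x::real in at_top. \<forall>n. norm (1 / real n ^ 2 * exp (- x) ^ n) \<le> 1 / real n ^ 2"
      using eventually_gt_at_top[of 0]
      by eventually_elim (auto simp: mult_le_one power_le_one intro!: divide_right_mono)
  qed (use s in \<open>auto simp: sums_iff\<close>)
  thus ?thesis unfolding dilog_exp_def [abs_def] by simp
qed

text \<open>Subtracting the antiderivative \<open>x * ln x - x\<close> of \<open>ln\<close> leaves a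
  function with derivative \<open>ln1mexp x - ln x\<close>, which lies between \<open>-x\<close> and
  0. The logarithmic singularity is gone and increments near 0 are quadratically small.\<close>

definition dilog_remainder :: "real \<Rightarrow> real" where
  "dilog_remainder x = dilog_exp x - (x * ln x - x)"

lemma dilog_remainder_diff:
  assumes "0 < s" "s \<le> t"
  shows   "\<bar>dilog_remainder t - dilog_remainder s\<bar> \<le> t * (t - s)"
proof -
  have "norm (dilog_remainder t - dilog_remainder s) \<le> t * norm (t - s)"
  proof (rule field_differentiable_bound[of "{s..t}"])
    fix x assume x: "x \<in> {s..t}"
    hence "x > 0" using assms by simp
    have "(dilog_remainder has_real_derivative (ln1mexp x - ln x)) (at x)"
      unfolding dilog_remainder_def using \<open>x > 0\<close> has_real_derivative_dilog_exp[OF \<open>x > 0\<close>]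
      by (auto intro!: derivative_eq_intros)
    thus "(dilog_remainder has_field_derivative (ln1mexp x - ln x)) (at x within {s..t})"
      by (rule has_field_derivative_at_within)
    show "norm (ln1mexp x - ln x) \<le> t"
      using ln1mexp_bounds[OF \<open>x > 0\<close>] x by auto
  qed (use assms in auto)
  thus ?thesis using assms by simp
qed

text \<open>Let \<open>s\<close> tend to 0 in \<open>dilog_remainder_diff\<close>. The outcome is
  the expansion \<open>dilog_exp t = pi^2 / 6 + t ln t - t + O(t^2)\<close>.\<close>

lemma dilog_remainder_near_0:
  assumes "t > 0"
  shows   "\<bar>dilog_remainder t - pi\<^sup>2 / 6\<bar> \<le> t\<^sup>2"
proof -
  have "((\<lambda>x::real. x * ln x - x) \<longlongrightarrow> 0) (at_right 0)" by real_asymp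
  hence "(dilog_remainder \<longlongrightarrow> pi\<^sup>2 / 6 - 0) (at_right 0)"
    unfolding dilog_remainder_def [abs_def] by (intro tendsto_diff dilog_exp_at_right_0)
  hence "((\<lambda>s. \<bar>dilog_remainder t - dilog_remainder s\<bar>) \<longlongrightarrow> \<bar>dilog_remainder t - pi\<^sup>2 / 6\<bar>) (at_right 0)"
    by (intro tendsto_intros) simp
  moreover have "\<forall>\<^sub>F s in at_right 0. \<bar>dilog_remainder t - dilog_remainder s\<bar> \<le> t\<^sup>2"
    using eventually_at_right_less[of 0] eventually_at_right_real[OF assms]
  proof eventually_elim
    case (elim s)
    have "\<bar>dilog_remainder t - dilog_remainder s\<bar> \<le> t * (t - s)"
      using elim by (intro dilog_remainder_diff) auto
    also have "\<dots> \<le> t\<^sup>2" using elim assms by (simp add: power2_eq_square mult_left_mono)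
    finally show ?case .
  qed
  ultimately show ?thesis by (rule tendsto_upperbound) simp
qed

section \<open>Trapezoidal errors and their limit as t tends to 0\<close>

definition ln_trapezoid :: "nat \<Rightarrow> real" where
  "ln_trapezoid k = (ln (real k) + ln (real k + 1)) / 2 - ((real k + 1) * ln (real k + 1) - real k * ln (real k) - 1)"

text \<open>The trapezoidal error on \<open>[k, k + 1]\<close> of the function taking
  \<open>x\<close> to \<open>ln1mexp (x * t)\<close>, whose antiderivative is
  \<open>dilog_exp (x * t) / t\<close>; \<open>ln_trapezoid k\<close> is the same error for
  \<open>ln\<close>. Using the unit grid instead of the grid of width \<open>t\<close> makes the two
  comparable.\<close>

definition ln1mexp_trapezoid :: "real \<Rightarrow> nat \<Rightarrow> real" where
  "ln1mexp_trapezoid t k = (ln1mexp (real k * t) + ln1mexp ((real k + 1) * t)) / 2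
     - (dilog_exp ((real k + 1) * t) - dilog_exp (real k * t)) / t"

text \<open>On \<open>[k t, (k + 1) t]\<close> the second derivative is at most
  \<open>1 / (k t)^2\<close> and the step is \<open>t\<close>; returning to the unit grid divides by
  \<open>t\<close>, and all powers of \<open>t\<close> cancel. Tannery's theorem requires exactly
  such a summable bound independent of \<open>t\<close>.\<close>

lemma ln1mexp_trapezoid_bound:
  assumes "t > 0" "k > 0"
  shows   "\<bar>ln1mexp_trapezoid t k\<bar> \<le> 1 / (2 * real k ^ 2)"
proof -
  define a where "a = real k * t"
  define b where "b = (real k + 1) * t"
  have ab: "0 < a" "a \<le> b" "b - a = t" using assms by (auto simp: a_def b_def algebra_simps)
  have "\<bar>(b - a) * (ln1mexp a + ln1mexp b) / 2 - (dilog_exp b - dilog_exp a)\<bar> \<le> 1 / a\<^sup>2 * (b - a) ^ 3 / 2"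
  proof (rule trapezoid_error)
    fix x assume x: "a \<le> x" "x \<le> b"
    hence x0: "x > 0" using ab by simp
    show "(dilog_exp has_real_derivative ln1mexp x) (at x)" by (rule has_real_derivative_dilog_exp[OF x0])
    show "(ln1mexp has_real_derivative 1 / (exp x - 1)) (at x)" by (rule has_real_derivative_ln1mexp[OF x0])
    show "((\<lambda>x. 1 / (exp x - 1)) has_real_derivative - (exp x / (exp x - 1)\<^sup>2)) (at x)"
      using x0 by (auto intro!: derivative_eq_intros simp: power2_eq_square)
    have "exp x / (exp x - 1)\<^sup>2 \<le> 1 / x\<^sup>2" by (rule exp_div_exp_minus_one_squared_le[OF x0])
    also have "\<dots> \<le> 1 / a\<^sup>2" using ab x by (intro divide_left_mono power_mono) auto
    finally show "\<bar>- (exp x / (exp x - 1)\<^sup>2)\<bar> \<le> 1 / a\<^sup>2" by simp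
  qed (use ab in auto)
  also have "(b - a) * (ln1mexp a + ln1mexp b) / 2 - (dilog_exp b - dilog_exp a) = t * ln1mexp_trapezoid t k"
    unfolding ln1mexp_trapezoid_def a_def [symmetric] b_def [symmetric] ab(3)
    using assms by (simp add: right_diff_distrib diff_divide_distrib)
  also have "1 / a\<^sup>2 * (b - a) ^ 3 / 2 = t * (1 / (2 * real k ^ 2))"
    unfolding ab(3) using assms by (simp add: a_def power2_eq_square power3_eq_cube)
  finally have "t * \<bar>ln1mexp_trapezoid t k\<bar> \<le> t * (1 / (2 * real k ^ 2))"
    using assms by (simp add: abs_mult)
  thus ?thesis using mult_le_cancel_left_pos[OF assms(1)] by blast
qed

text \<open>The trapezoidal rule is exact on the constant \<open>ln t\<close>, so
  \<open>ln (x * t)\<close> has the same error as \<open>ln x\<close>. What remains are two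
  differences \<open>ln1mexp - ln\<close> and an increment of \<open>dilog_remainder\<close>, each
  bounded by the right end point \<open>b\<close>. The bound grows with \<open>k\<close>, but only
  the limit for fixed \<open>k\<close> is wanted.\<close>

lemma ln1mexp_trapezoid_diff:
  assumes "t > 0" "k > 0"
  shows   "\<bar>ln1mexp_trapezoid t k - ln_trapezoid k\<bar> \<le> 2 * (real k + 1) * t"
proof -
  define a where "a = real k * t"
  define b where "b = (real k + 1) * t"
  have ab: "0 < a" "a \<le> b" "b - a = t" using assms by (auto simp: a_def b_def algebra_simps)
  have b: "b > 0" using ab by simp
  have lna: "ln a = ln (real k) + ln t" using assms by (simp add: a_def ln_mult)
  have lnb: "ln b = ln (real k + 1) + ln t" using assms by (simp add: b_def ln_mult)
  have dil: "dilog_exp b - dilog_exp a = (dilog_remainder b - dilog_remainder a) + (b * ln b - b) - (a * ln a - a)"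
    by (simp add: dilog_remainder_def)
  have "(b * ln b - b) - (a * ln a - a) = t * ((real k + 1) * ln (real k + 1) - real k * ln (real k) - 1 + ln t)"
    unfolding lna lnb by (simp add: a_def b_def algebra_simps)
  hence dil': "(dilog_exp b - dilog_exp a) / t = (dilog_remainder b - dilog_remainder a) / t +
     ((real k + 1) * ln (real k + 1) - real k * ln (real k) - 1 + ln t)"
    using assms unfolding dil by (simp add: field_simps)
  have eq: "ln1mexp_trapezoid t k - ln_trapezoid k =
          (ln1mexp a - ln a) / 2 + (ln1mexp b - ln b) / 2 - (dilog_remainder b - dilog_remainder a) / t"
    unfolding ln1mexp_trapezoid_def ln_trapezoid_def a_def [symmetric] b_def [symmetric] dil'
    unfolding lna lnb by (simp add: field_simps)
  have "\<bar>(dilog_remainder b - dilog_remainder a) / t\<bar> \<le> b * (b - a) / t"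
    unfolding abs_divide using ab assms dilog_remainder_diff[of a b] by (intro divide_mono) auto
  hence "\<bar>(dilog_remainder b - dilog_remainder a) / t\<bar> \<le> b" using ab assms by simp
  moreover have "\<bar>ln1mexp a - ln a\<bar> \<le> b" "\<bar>ln1mexp b - ln b\<bar> \<le> b"
    using ln1mexp_bounds[of a] ln1mexp_bounds[of b] ab by auto
  moreover have "\<bar>x / 2 + y / 2 - z\<bar> \<le> 2 * b" if "\<bar>x\<bar> \<le> b" "\<bar>y\<bar> \<le> b" "\<bar>z\<bar> \<le> b" for x y z :: real
    using that by linarith
  ultimately have "\<bar>ln1mexp_trapezoid t k - ln_trapezoid k\<bar> \<le> 2 * b" unfolding eq by blast
  thus ?thesis by (simp only: b_def mult.assoc)
qed

lemma ln1mexp_trapezoid_suminf_tendsto: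
  "summable (\<lambda>k. ln_trapezoid (Suc k))"
  "((\<lambda>t. \<Sum>k. ln1mexp_trapezoid t (Suc k)) \<longlongrightarrow> (\<Sum>k. ln_trapezoid (Suc k))) (at_right 0)"
proof -
  have lim: "((\<lambda>t. ln1mexp_trapezoid t (Suc k)) \<longlongrightarrow> ln_trapezoid (Suc k)) (at_right 0)" for k
  proof (rule LIM_zero_cancel, rule Lim_null_comparison)
    show "\<forall>\<^sub>F t in at_right 0. norm (ln1mexp_trapezoid t (Suc k) - ln_trapezoid (Suc k)) \<le> 2 * (real (Suc k) + 1) * t"
      using eventually_at_right_less[of 0]
      by eventually_elim (use ln1mexp_trapezoid_diff[of _ "Suc k"] in auto)
    show "((\<lambda>t. 2 * (real (Suc k) + 1) * t) \<longlongrightarrow> 0) (at_right 0)"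
      by (auto intro!: tendsto_eq_intros)
  qed
  have ev: "\<forall>\<^sub>F t in at_right 0. \<forall>k. norm (ln1mexp_trapezoid t (Suc k)) \<le> 1 / (2 * real (Suc k) ^ 2)"
    using eventually_at_right_less[of 0]
    by eventually_elim (use ln1mexp_trapezoid_bound[of _ "Suc _"] in auto)
  have "summable (\<lambda>k. 1 / 2 * (1 / real (Suc k) ^ 2))"
    using inverse_squares_sums by (intro summable_mult) (simp add: sums_iff add_ac)
  hence summ: "summable (\<lambda>k. 1 / (2 * real (Suc k) ^ 2))" by simp
  show "summable (\<lambda>k. ln_trapezoid (Suc k))"
    "((\<lambda>t. \<Sum>k. ln1mexp_trapezoid t (Suc k)) \<longlongrightarrow> (\<Sum>k. ln_trapezoid (Suc k))) (at_right 0)"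
    using tannery[OF lim ev summ] by simp_all
qed

text \<open>Inner nodes collect weight 1 and the two end nodes weight 1/2, while the integrals
  telescope.\<close>

lemma ln1mexp_trapezoid_sum:
  assumes "t > 0"
  shows "(\<Sum>k<n. ln1mexp_trapezoid t (Suc k)) = (\<Sum>k=1..Suc n. ln1mexp (real k * t))
           - ln1mexp t / 2 - ln1mexp (real (Suc n) * t) / 2 - (dilog_exp (real (Suc n) * t) - dilog_exp t) / t"
proof (induction n)
  case (Suc n)
  have "real (Suc n) + 1 = real (Suc (Suc n))" by simp
  hence T: "ln1mexp_trapezoid t (Suc n) = (ln1mexp (real (Suc n) * t) + ln1mexp (real (Suc (Suc n)) * t)) / 2
     - (dilog_exp (real (Suc (Suc n)) * t) - dilog_exp (real (Suc n) * t)) / t"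
    by (simp only: ln1mexp_trapezoid_def)
  show ?case
    unfolding sum.lessThan_Suc Suc.IH T
    by (simp add: diff_divide_distrib add_divide_distrib del: of_nat_Suc)
qed simp

lemma ln1mexp_trapezoid_sums:
  assumes "t > 0" and S: "(\<lambda>K. \<Sum>k=1..K. ln1mexp (real k * t)) \<longlonglongrightarrow> S"
  shows   "(\<lambda>k. ln1mexp_trapezoid t (Suc k)) sums (S - ln1mexp t / 2 + dilog_exp t / t)"
proof -
  have lim: "filterlim (\<lambda>n. real (Suc n) * t) at_top sequentially"
    using assms by real_asymp
  have "((\<lambda>x. ln1mexp x) \<longlongrightarrow> 0) at_top"
    unfolding ln1mexp_def by real_asymp
  from filterlim_compose[OF this lim] filterlim_compose[OF dilog_exp_at_top lim]
  have "(\<lambda>n. (\<Sum>k=1..Suc n. ln1mexp (real k * t)) - ln1mexp t / 2 - ln1mexp (real (Suc n) * t) / 2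
               - (dilog_exp (real (Suc n) * t) - dilog_exp t) / t)
          \<longlonglongrightarrow> S - ln1mexp t / 2 - 0 / 2 - (0 - dilog_exp t) / t"
    using S assms by (intro tendsto_intros filterlim_compose[OF S filterlim_Suc]) auto
  thus ?thesis unfolding sums_def ln1mexp_trapezoid_sum[OF assms(1)] by simp
qed

section \<open>Stirling's constant from Wallis' product\<close>

definition stirling_seq :: "nat \<Rightarrow> real" where
  "stirling_seq n = ln (fact n) - (real n + 1 / 2) * ln (real n) + real n"

lemma ln_trapezoid_sum:
  "(\<Sum>k<n. ln_trapezoid (Suc k)) = stirling_seq (Suc n) - 1"
proof (induction n)
  case (Suc n)
  have "ln (fact (Suc (Suc n)) :: real) = ln (real n + 2) + ln (fact (Suc n))"
    by (subst fact_Suc, subst ln_mult) (auto simp: add_ac)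
  moreover have "ln_trapezoid (Suc n) = (ln (real n + 1) + ln (real n + 2)) / 2
                   - ((real n + 2) * ln (real n + 2) - (real n + 1) * ln (real n + 1) - 1)"
    by (simp add: ln_trapezoid_def add_ac)
  ultimately show ?case
    unfolding sum.lessThan_Suc Suc.IH by (simp add: stirling_seq_def algebra_simps add_divide_distrib del: fact_Suc)
qed (simp add: stirling_seq_def)

text \<open>Expresses Wallis' product by the factorials of \<open>n\<close> and
  \<open>2 * n\<close>, so that its logarithm can be written through
  \<open>stirling_seq\<close>.\<close>

lemma wallis_product_fact:
  "(\<Prod>k=1..n. (4 * real k ^ 2) / (4 * real k ^ 2 - 1)) = 2 ^ (4 * n) * fact n ^ 4 / (fact (2 * n) ^ 2 * (2 * real n + 1))"
proof (induction n)
  case (Suc n)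
  define x where "x = real n"
  have f1: "fact (Suc n) = (x + 1) * fact n" by (simp add: x_def)
  have f2: "fact (2 * Suc n) = (2 * x + 2) * (2 * x + 1) * (fact (2 * n) :: real)"
    by (simp add: x_def algebra_simps)
  have p: "(2 :: real) ^ (4 * Suc n) = 16 * 2 ^ (4 * n)" by (simp add: power_add)
  have x: "x \<ge> 0" by (simp add: x_def)
  have "4 * (x + 1) ^ 2 - 1 = (2 * x + 1) * (2 * x + 3)" by (simp add: power2_eq_square algebra_simps)
  hence "(\<Prod>k=1..Suc n. (4 * real k ^ 2) / (4 * real k ^ 2 - 1)) =
          2 ^ (4 * n) * fact n ^ 4 / (fact (2 * n) ^ 2 * (2 * x + 1)) * (4 * (x + 1) ^ 2 / ((2 * x + 1) * (2 * x + 3)))"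
    using Suc.IH by (simp add: x_def add_ac)
  also have "\<dots> = 2 ^ (4 * Suc n) * fact (Suc n) ^ 4 / (fact (2 * Suc n) ^ 2 * (2 * real (Suc n) + 1))"
  proof -
    have "a * b ^ 4 / (c ^ 2 * (2 * x + 1)) * (4 * (x + 1) ^ 2 / ((2 * x + 1) * (2 * x + 3))) =
            16 * a * ((x + 1) * b) ^ 4 / (((2 * x + 2) * (2 * x + 1) * c) ^ 2 * (2 * x + 3))"
      if "c > 0" for a b c :: real
    proof -
      have nz: "c \<noteq> 0" "2 * x + 1 \<noteq> 0" "2 * x + 3 \<noteq> 0" "2 * x + 2 \<noteq> 0" using x that by auto
      have "2 * x + 2 = 2 * (x + 1)" by simp
      thus ?thesis using nz by (simp add: divide_simps) (simp add: eval_nat_numeral algebra_simps)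
    qed
    from this[of "fact (2 * n)" "2 ^ (4 * n)" "fact n"] show ?thesis
      unfolding f1 f2 p by (simp add: x_def add_ac)
  qed
  finally show ?case .
qed simp

text \<open>In the logarithm of the formula in \<open>wallis_product_fact\<close> the terms of size
  \<open>n ln n\<close> and \<open>n\<close> cancel, leaving
  \<open>4 * stirling_seq n - 2 * stirling_seq (2 * n)\<close> and elementary terms. In the limit
  this reads \<open>2 c - 2 ln 2 = ln (pi / 2)\<close>.\<close>

lemma stirling_constant:
  assumes "stirling_seq \<longlonglongrightarrow> c"
  shows   "c = ln (2 * pi) / 2"
proof -
  define P where "P = (\<lambda>n. \<Prod>k=1..n. (4 * real k ^ 2) / (4 * real k ^ 2 - 1))"
  have lim1: "(\<lambda>n. ln (P n)) \<longlonglongrightarrow> ln (pi / 2)"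
    unfolding P_def by (intro tendsto_ln wallis) auto
  have lim2: "(\<lambda>n. 4 * stirling_seq n - 2 * stirling_seq (2 * n) - ln 2 + ln (real n / (2 * real n + 1)))
                    \<longlonglongrightarrow> 4 * c - 2 * c - ln 2 + ln (1 / 2)"
  proof -
    have "(\<lambda>n. stirling_seq (2 * n)) \<longlonglongrightarrow> c"
      by (rule filterlim_compose[OF assms]) (auto intro!: filterlim_subseq simp: strict_mono_def)
    moreover have "(\<lambda>n. ln (real n / (2 * real n + 1))) \<longlonglongrightarrow> ln (1 / 2)"
      by real_asymp
    ultimately show ?thesis by (intro tendsto_add tendsto_diff tendsto_mult tendsto_const assms)
  qed
  have "\<forall>\<^sub>F n in sequentially.
     4 * stirling_seq n - 2 * stirling_seq (2 * n) - ln 2 + ln (real n / (2 * real n + 1)) = ln (P n)"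
    using eventually_gt_at_top[of 0]
  proof eventually_elim
    case (elim n)
    have "ln (P n) = ln (2 ^ (4 * n) * fact n ^ 4) - ln (fact (2 * n) ^ 2 * (2 * real n + 1))"
      unfolding P_def wallis_product_fact by (subst ln_div) (auto intro!: mult_pos_pos add_nonneg_pos)
    also have "\<dots> = 4 * real n * ln 2 + 4 * ln (fact n) - 2 * ln (fact (2 * n)) - ln (2 * real n + 1)"
      by (simp add: ln_mult ln_realpow)
    finally show ?case using elim
      by (simp add: stirling_seq_def ln_mult ln_div algebra_simps)
  qed
  from LIMSEQ_unique[OF lim1 Lim_transform_eventually[OF lim2 this]]
  have "ln (pi / 2) = 4 * c - 2 * c - ln 2 + ln (1 / 2)" .
  thus ?thesis by (simp add: ln_div ln_mult)
qed

text \<open>Summability of the errors of \<open>ln\<close>, a by-product of Tannery's theorem, makes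
  \<open>stirling_seq\<close> converge; Wallis' product then identifies the limit.\<close>

lemma ln_trapezoid_suminf: "(\<Sum>k. ln_trapezoid (Suc k)) = ln (2 * pi) / 2 - 1"
proof -
  define S where "S = (\<Sum>k. ln_trapezoid (Suc k))"
  have "(\<lambda>n. stirling_seq (Suc n) - 1) \<longlonglongrightarrow> S"
    using summable_LIMSEQ[OF ln1mexp_trapezoid_suminf_tendsto(1)] by (simp add: S_def ln_trapezoid_sum)
  hence "(\<lambda>n. stirling_seq (Suc n) - 1 + 1) \<longlonglongrightarrow> S + 1" by (intro tendsto_intros)
  hence "stirling_seq \<longlonglongrightarrow> S + 1" by (simp add: filterlim_sequentially_Suc)
  from stirling_constant[OF this] show ?thesis by (simp add: S_def)
qed

text \<open>Summing the trapezoidal errors gives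
  \<open>S t = E t + ln1mexp t / 2 - dilog_exp t / t\<close>. Up to \<open>o(1)\<close>, the last
  term contributes \<open>- pi^2 / (6 t) - ln t + 1\<close> and the middle one
  \<open>ln t / 2\<close>, while \<open>E t\<close> tends to
  \<open>ln (2 pi) / 2 - 1\<close>.\<close>

lemma ln1mexp_sum_asymptotics:
  assumes S: "\<And>t. t > 0 \<Longrightarrow> (\<lambda>K. \<Sum>k=1..K. ln1mexp (real k * t)) \<longlonglongrightarrow> S t"
  shows   "((\<lambda>t. S t + pi\<^sup>2 / (6 * t) + ln t / 2) \<longlongrightarrow> ln (2 * pi) / 2) (at_right 0)"
proof -
  define E where "E = (\<lambda>t. \<Sum>k. ln1mexp_trapezoid t (Suc k))"
  have "((\<lambda>t. (ln1mexp t - ln t) / 2) \<longlongrightarrow> 0) (at_right 0)"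
    unfolding ln1mexp_def by real_asymp
  moreover have "((\<lambda>t. (dilog_remainder t - pi\<^sup>2 / 6) / t) \<longlongrightarrow> 0) (at_right 0)"
  proof (rule Lim_null_comparison)
    show "\<forall>\<^sub>F t in at_right 0. norm ((dilog_remainder t - pi\<^sup>2 / 6) / t) \<le> t"
      using eventually_at_right_less[of 0]
    proof eventually_elim
      case (elim t)
      thus ?case using dilog_remainder_near_0[of t] by (simp add: divide_le_eq power2_eq_square)
    qed
  qed (auto intro!: tendsto_eq_intros)
  ultimately have "((\<lambda>t. E t + (ln1mexp t - ln t) / 2 - (dilog_remainder t - pi\<^sup>2 / 6) / t + 1) \<longlongrightarrow>
                     (ln (2 * pi) / 2 - 1) + 0 - 0 + 1) (at_right 0)"
    using ln1mexp_trapezoid_suminf_tendsto(2) unfolding E_def ln_trapezoid_suminf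
    by (intro tendsto_intros)
  hence lim: "((\<lambda>t. E t + (ln1mexp t - ln t) / 2 - (dilog_remainder t - pi\<^sup>2 / 6) / t + 1) \<longlongrightarrow>
                     ln (2 * pi) / 2) (at_right 0)" by simp
  have "\<forall>\<^sub>F t in at_right 0. E t + (ln1mexp t - ln t) / 2 - (dilog_remainder t - pi\<^sup>2 / 6) / t + 1
                    = S t + pi\<^sup>2 / (6 * t) + ln t / 2"
    using eventually_at_right_less[of 0]
  proof eventually_elim
    case (elim t)
    have "E t = S t - ln1mexp t / 2 + dilog_exp t / t"
      using ln1mexp_trapezoid_sums[OF _ S] elim by (simp add: E_def sums_iff)
    moreover have "(dilog_remainder t - pi\<^sup>2 / 6) / t = dilog_exp t / t - ln t + 1 - pi\<^sup>2 / (6 * t)"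
      using elim by (simp add: dilog_remainder_def field_simps)
    ultimately show ?case by (simp add: diff_divide_distrib)
  qed
  from Lim_transform_eventually[OF lim this] show ?thesis .
qed

section \<open>Fourier inversion\<close>

lemma has_bochner_integral_cis:
  fixes m :: int
  shows "has_bochner_integral lborel (\<lambda>x. indicator {-pi..pi} x *\<^sub>R cis (of_int m * x))
           (if m = 0 then 2 * pi else 0)"
proof (cases "m = 0")
  case True
  have "has_bochner_integral lborel (\<lambda>x. indicator {-pi..pi} x *\<^sub>R (1 :: complex)) (of_real pi - of_real (-pi))"
    by (rule has_bochner_integral_FTC_Icc) (auto intro!: derivative_eq_intros simp: has_vector_derivative_of_real)
  thus ?thesis using True by simp
next
  case False
  define F where "F = (\<lambda>x. cis (of_int m * x) / (\<i> * of_int m))"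
  have "has_bochner_integral lborel (\<lambda>x. indicator {-pi..pi} x *\<^sub>R cis (of_int m * x)) (F pi - F (-pi))"
  proof (rule has_bochner_integral_FTC_Icc)
    fix x :: real
    have "((\<lambda>x. exp (\<i> * of_int m * of_real x) / (\<i> * of_int m)) has_vector_derivative
             exp (\<i> * of_int m * of_real x)) (at x within {-pi..pi})"
      by (rule has_vector_derivative_real_field) (use False in \<open>auto intro!: derivative_eq_intros\<close>)
    thus "(F has_vector_derivative cis (of_int m * x)) (at x within {-pi..pi})"
      unfolding F_def cis_conv_exp by (simp add: mult_ac)
  qed (auto intro!: continuous_intros)
  also have "F pi = F (-pi)"
  proof -
    have "cis (of_int m * pi) = cis (- (of_int m * pi))"
      by (simp add: complex_eq_iff sin_times_pi_eq_0 mult.commute)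
    thus ?thesis by (simp add: F_def)
  qed
  finally show ?thesis using False by simp
qed

text \<open>Orthogonality of the functions \<open>cis (m * x)\<close> after termwise integration,
  which the absolute summability of \<open>a\<close> permits.\<close>

lemma has_bochner_integral_fourier_coefficient:
  fixes a :: "nat \<Rightarrow> complex"
  assumes a: "summable (\<lambda>k. norm (a k))"
  shows "has_bochner_integral lborel
           (\<lambda>x. indicator {-pi..pi} x *\<^sub>R ((\<Sum>k. a k * cis (- real k * x)) * cis (real n * x)))
           (2 * pi * a n)"
proof -
  define f where "f = (\<lambda>k x. indicator {-pi..pi} x *\<^sub>R (a k * cis (of_int (int n - int k) * x)))"
  have hbi: "has_bochner_integral lborel (f k) (if k = n then 2 * pi * a n else 0)" for k
  proof -
    have "has_bochner_integral lborel (\<lambda>x. a k * (indicator {-pi..pi} x *\<^sub>R cis (of_int (int n - int k) * x)))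
            (a k * (if int n - int k = 0 then 2 * pi else 0))"
      using has_bochner_integral_mult_right[OF has_bochner_integral_cis[of "int n - int k"], of "a k"]
      by (cases "k = n") auto
    thus ?thesis unfolding f_def by (auto simp: mult_ac)
  qed
  have norm_f: "norm (f k x) = norm (a k) * indicator {-pi..pi} x" for k x
    by (simp add: f_def norm_mult)
  have int_norm: "(\<integral>x. norm (f k x) \<partial>lborel) = norm (a k) * (2 * pi)" for k
    unfolding norm_f by simp
  have integ: "integrable lborel (f k)" for k using hbi integrable.intros by blast
  have summ: "summable (\<lambda>k. norm (f k x))" for x
    unfolding norm_f by (intro summable_mult2 a)
  have summ_int: "summable (\<lambda>k. \<integral>x. norm (f k x) \<partial>lborel)"
    unfolding int_norm by (intro summable_mult2 a)
  have "integrable lborel (\<lambda>x. \<Sum>k. f k x)"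
    by (rule integrable_suminf[OF integ _ summ_int]) (simp add: summ)
  moreover have "(\<integral>x. (\<Sum>k. f k x) \<partial>lborel) = 2 * pi * a n"
  proof -
    have "(\<integral>x. (\<Sum>k. f k x) \<partial>lborel) = (\<Sum>k. \<integral>x. f k x \<partial>lborel)"
      by (rule integral_suminf[OF integ _ summ_int]) (simp add: summ)
    also have "\<dots> = (\<Sum>k. if k = n then 2 * pi * a n else 0)"
      using hbi[THEN has_bochner_integral_integral_eq] by simp
    also have "\<dots> = 2 * pi * a n" using sums_single[of n "\<lambda>_. 2 * pi * a n"] by (simp add: sums_iff)
    finally show ?thesis .
  qed
  ultimately have "has_bochner_integral lborel (\<lambda>x. \<Sum>k. f k x) (2 * pi * a n)"
    by (simp add: has_bochner_integral_iff)
  also have "(\<lambda>x. \<Sum>k. f k x) =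
    (\<lambda>x. indicator {-pi..pi} x *\<^sub>R ((\<Sum>k. a k * cis (- real k * x)) * cis (real n * x)))"
  proof
    fix x :: real
    have s: "summable (\<lambda>k. a k * cis (- real k * x))"
      by (rule summable_norm_cancel) (use a in \<open>simp add: norm_mult\<close>)
    have "f k x = indicator {-pi..pi} x *\<^sub>R ((a k * cis (- real k * x)) * cis (real n * x))" for k
      by (simp add: f_def cis_mult algebra_simps)
    thus "(\<Sum>k. f k x) = indicator {-pi..pi} x *\<^sub>R ((\<Sum>k. a k * cis (- real k * x)) * cis (real n * x))"
      using s by (simp add: suminf_scaleR_right suminf_mult2 summable_mult2)
  qed
  finally show ?thesis .
qed

text \<open>The function \<open>L\<close> of the overview; the series given there is
  \<open>log_partition_gf_sums\<close>.\<close>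

definition log_partition_gf :: "complex \<Rightarrow> complex" where
  "log_partition_gf \<tau> = log_partition_series (exp (-\<tau>))"

text \<open>On the circle of radius \<open>exp (-t)\<close> the coefficient is damped by
  \<open>exp (-t) ^ n\<close>, and the factor \<open>exp (n * t)\<close> undoes this. The value is
  the same for every \<open>t > 0\<close>, so \<open>t\<close> may later depend on
  \<open>n\<close>.\<close>

lemma has_bochner_integral_partition_number:
  assumes "t > 0"
  shows "has_bochner_integral lborel
           (\<lambda>x. indicator {-pi..pi} x *\<^sub>R exp (log_partition_gf (Complex t x) + of_nat n * Complex t x))
           (2 * pi * of_nat (partition_number n))"
proof -
  define a where "a = (\<lambda>k. of_nat (partition_number k) * of_real (exp (-t)) ^ k :: complex)"
  have "summable (\<lambda>k. norm (a k))"
    using summable_partition_number[of "exp (-t)"] assms by (simp add: a_def norm_mult norm_power)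
  note hbi = has_bochner_integral_mult_right[OF has_bochner_integral_fourier_coefficient[OF this, of n],
      of "of_real (exp (real n * t))"]
  have "of_real (exp (real n * t)) * (indicator {-pi..pi} x *\<^sub>R ((\<Sum>k. a k * cis (- real k * x)) * cis (real n * x)))
     = indicator {-pi..pi} x *\<^sub>R exp (log_partition_gf (Complex t x) + of_nat n * Complex t x)" for x
  proof -
    have e: "exp (- Complex t x) = of_real (exp (-t)) * cis (-x)"
      by (simp add: exp_eq_polar)
    have "cis (- real k * x) = cis (-x) ^ k" for k by (subst Complex.DeMoivre) simp
    hence "a k * cis (- real k * x) = of_nat (partition_number k) * exp (- Complex t x) ^ k" for k
      by (simp add: a_def e power_mult_distrib del: mult_minus_left)
    hence "(\<Sum>k. a k * cis (- real k * x)) = exp (log_partition_gf (Complex t x))"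
      using partition_number_generating_function[of "exp (- Complex t x)"] assms
      by (simp add: log_partition_gf_def sums_iff)
    moreover have "exp (of_nat n * Complex t x) = of_real (exp (real n * t)) * cis (real n * x)"
      by (simp add: exp_eq_polar)
    ultimately show ?thesis by (simp add: exp_add mult_ac)
  qed
  moreover have "of_real (exp (real n * t)) * (2 * pi * a n) = 2 * pi * of_nat (partition_number n)"
  proof -
    have "exp (real n * t) * exp (-t) ^ n = 1" by (simp flip: exp_of_nat_mult exp_add)
    hence "complex_of_real (exp (real n * t)) * of_real (exp (-t)) ^ n = 1"
      by (metis of_real_1 of_real_mult of_real_power)
    thus ?thesis by (simp add: a_def)
  qed
  ultimately show ?thesis using hbi by (simp only: of_real_mult of_real_numeral)
qed

section \<open>Comparison with the real axis near the saddle point\<close>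

lemma exp_minus_one_neq_0:
  assumes "Re z > 0"
  shows   "exp z - 1 \<noteq> 0"
proof
  assume "exp z - 1 = 0"
  hence "exp z = 1" by simp
  hence "exp (Re z) = 1" by (metis norm_exp_eq_Re norm_one)
  thus False using assms by simp
qed

lemma norm_exp_minus_one_ge:
  fixes z :: complex
  shows "norm (exp z - 1) \<ge> exp (Re z) - 1"
  using norm_triangle_ineq2[of "exp z" 1] by simp

lemma bose_derivative_bound_far:
  fixes z :: complex
  assumes "Re z > 0"
  shows   "norm (exp z / (exp z - 1)\<^sup>2) \<le> 1 / (Re z)\<^sup>2"
proof -
  define r where "r = Re z"
  have r: "r > 0" using assms by (simp add: r_def)
  have "norm (exp z / (exp z - 1)\<^sup>2) = exp r / (norm (exp z - 1))\<^sup>2"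
    by (simp add: norm_divide norm_power r_def)
  also have "\<dots> \<le> exp r / (exp r - 1)\<^sup>2"
    using norm_exp_minus_one_ge[of z] r unfolding r_def
    by (intro divide_left_mono power_mono mult_pos_pos zero_less_power) (auto intro: order.strict_trans2)
  also have "\<dots> \<le> 1 / r\<^sup>2" by (rule exp_div_exp_minus_one_squared_le[OF r])
  finally show ?thesis by (simp add: r_def)
qed

text \<open>The expression is the derivative of \<open>1 / (exp z - 1) - 1 / z\<close>, whose
  singularity at 0 is removable. With \<open>A = (exp z - 1) / z\<close> it equals
  \<open>(A^2 - exp z) / (z^2 A^2)\<close>, and \<open>z^2\<close> divides the numerator because
  \<open>A^2\<close> and \<open>exp z\<close> both begin with \<open>1 + z\<close>. The scaled
  Taylor remainders \<open>D\<close> and \<open>B\<close> make this quantitative.\<close>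

lemma bose_derivative_bound_near:
  fixes z :: complex
  assumes "z \<noteq> 0" "norm z \<le> 1 / 4"
  shows   "norm (1 / z\<^sup>2 - exp z / (exp z - 1)\<^sup>2) \<le> 48"
proof -
  have e: "exp \<bar>Re z\<bar> \<le> 3"
  proof -
    have "\<bar>Re z\<bar> \<le> 1" using abs_Re_le_cmod[of z] assms by linarith
    hence "exp \<bar>Re z\<bar> \<le> exp 1" by simp
    also have "\<dots> \<le> 3" using exp_le by simp
    finally show ?thesis .
  qed
  define D where "D = (exp z - 1 - z) / z\<^sup>2"
  define B where "B = (exp z - 1 - z - z\<^sup>2 / 2) / z ^ 3"
  define A where "A = (exp z - 1) / z"
  have "norm (exp z - (\<Sum>k\<le>1. z ^ k / fact k)) \<le> exp \<bar>Re z\<bar> * norm z ^ 2 / fact 1"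
    using Taylor_exp[of z 1] by (simp add: numeral_2_eq_2)
  also have "\<dots> \<le> 3 * norm z ^ 2" using e by (simp add: mult_right_mono)
  finally have D: "norm D \<le> 3" using assms by (simp add: D_def norm_divide norm_power divide_simps algebra_simps)
  have "norm (exp z - (\<Sum>k\<le>2. z ^ k / fact k)) \<le> exp \<bar>Re z\<bar> * norm z ^ 3 / fact 2"
    using Taylor_exp[of z 2] by (simp add: eval_nat_numeral)
  also have "\<dots> \<le> 3 * norm z ^ 3 / fact 2" using e by (intro divide_right_mono mult_right_mono) auto
  also have "exp z - (\<Sum>k\<le>2. z ^ k / fact k) = exp z - 1 - z - z\<^sup>2 / 2"
    by (simp add: eval_nat_numeral)
  finally have B: "norm B \<le> 3 / 2"
    using assms by (simp add: B_def norm_divide norm_power pos_divide_le_eq)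
  have A_eq: "A = 1 + z / 2 + z\<^sup>2 * B"
    using assms by (simp add: A_def B_def field_simps eval_nat_numeral)
  have exp_eq: "exp z = 1 + z + z\<^sup>2 * D" using assms by (simp add: D_def)
  have "norm (z / 2 + z\<^sup>2 * B) \<le> norm z / 2 + norm z ^ 2 * norm B"
    by (rule order_trans[OF norm_triangle_ineq]) (simp add: norm_mult norm_power norm_divide)
  also have "\<dots> \<le> (1 / 4) / 2 + (1 / 4)\<^sup>2 * (3 / 2)"
    using assms B by (intro add_mono mult_mono power_mono divide_right_mono) auto
  finally have "norm (z / 2 + z\<^sup>2 * B) \<le> 1 / 2" by (simp add: power2_eq_square)
  hence A: "norm A \<ge> 1 / 2"
  proof -
    have "norm (1 + w) \<ge> 1 - norm w" for w :: complex using norm_triangle_ineq2[of 1 "-w"] by simp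
    from this[of "z / 2 + z\<^sup>2 * B"] show ?thesis
      using \<open>norm (z / 2 + z\<^sup>2 * B) \<le> 1 / 2\<close> by (simp add: A_eq add.assoc)
  qed
  hence A0: "A \<noteq> 0" by auto
  have "1 / z\<^sup>2 - exp z / (exp z - 1)\<^sup>2 = (A\<^sup>2 - exp z) / (z\<^sup>2 * A\<^sup>2)"
    using assms A0 unfolding A_def by (simp add: divide_simps)
  also have "A\<^sup>2 - exp z = z\<^sup>2 * (1 / 4 + 2 * B + z * B + z\<^sup>2 * B\<^sup>2 - D)"
    unfolding A_eq exp_eq by (simp add: power2_eq_square algebra_simps)
  also have "\<dots> / (z\<^sup>2 * A\<^sup>2) = (1 / 4 + 2 * B + z * B + z\<^sup>2 * B\<^sup>2 - D) / A\<^sup>2"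
    using assms by simp
  finally have eq: "norm (1 / z\<^sup>2 - exp z / (exp z - 1)\<^sup>2) = norm (1 / 4 + 2 * B + z * B + z\<^sup>2 * B\<^sup>2 - D) / norm A ^ 2"
    by (simp add: norm_divide norm_power)
  have "norm (1 / 4 + 2 * B + z * B + z\<^sup>2 * B\<^sup>2 - D) \<le>
          1 / 4 + 2 * norm B + norm z * norm B + norm z ^ 2 * norm B ^ 2 + norm D"
    by (intro order_trans[OF norm_triangle_ineq4] order_trans[OF norm_triangle_ineq] add_mono)
       (auto simp: norm_mult norm_power)
  also have "\<dots> \<le> 1 / 4 + 2 * (3 / 2) + (1 / 4) * (3 / 2) + (1 / 4)\<^sup>2 * (3 / 2)\<^sup>2 + 3"
    using assms B D by (intro add_mono mult_mono power_mono) auto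
  also have "\<dots> \<le> 12" by (simp add: power2_eq_square)
  finally have "norm (1 / 4 + 2 * B + z * B + z\<^sup>2 * B\<^sup>2 - D) / norm A ^ 2 \<le> 12 / (1 / 2)\<^sup>2"
    using A by (intro frac_le power_mono) auto
  thus ?thesis unfolding eq by (simp add: power2_eq_square)
qed

text \<open>The left side is bounded near 0 and decays like \<open>1 / (Re z)^2\<close>, so every
  exponent from -2 to 0 is possible with some constant. The exponent -5/4 is below -1, so that the
  series over \<open>m\<close> in \<open>log_partition_gf_vertical_diff\<close> converges, and above
  -3/2, so that \<open>t powr (-5/4)\<close> times the vertical scale \<open>t powr (3/2)\<close>
  tends to 0.\<close>

lemma bose_derivative_bound:
  fixes z :: complex
  assumes z: "Re z > 0" "\<bar>Im z\<bar> \<le> Re z"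
  shows   "norm (1 / z\<^sup>2 - exp z / (exp z - 1)\<^sup>2) \<le> 48 * Re z powr (-5/4)"
proof -
  define r where "r = Re z"
  have r: "r > 0" using z by (simp add: r_def)
  have "norm z \<le> 2 * r" using cmod_le[of z] z by (simp add: r_def)
  have "r \<le> norm z" using abs_Re_le_cmod[of z] by (simp add: r_def)
  show ?thesis
  proof (cases "norm z \<le> 1 / 4")
    case True
    have "r powr (-5/4) \<ge> 1 powr (-5/4)"
      using True \<open>r \<le> norm z\<close> r by (intro powr_mono2') auto
    moreover have "norm (1 / z\<^sup>2 - exp z / (exp z - 1)\<^sup>2) \<le> 48"
      using True z by (intro bose_derivative_bound_near) auto
    ultimately show ?thesis by (simp add: r_def)
  next
    case False
    hence r8: "r \<ge> 1 / 8" using \<open>norm z \<le> 2 * r\<close> by simp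
    have "norm (1 / z\<^sup>2) \<le> 1 / r\<^sup>2"
      using r \<open>r \<le> norm z\<close> unfolding norm_divide norm_power norm_one
      by (intro divide_left_mono power_mono mult_pos_pos zero_less_power) linarith+
    moreover have "norm (exp z / (exp z - 1)\<^sup>2) \<le> 1 / r\<^sup>2"
      using bose_derivative_bound_far z by (simp add: r_def)
    moreover have "1 / r\<^sup>2 = r powr (-3/4) * r powr (-5/4)"
    proof -
      have "r powr (-3/4) * r powr (-5/4) = r powr (-2)" by (simp flip: powr_add)
      also have "\<dots> = 1 / r powr 2" using powr_minus_divide[of r 2] by simp
      finally show ?thesis using r by simp
    qed
    ultimately have le: "norm (1 / z\<^sup>2 - exp z / (exp z - 1)\<^sup>2) \<le> 2 * (r powr (-3/4) * r powr (-5/4))"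
      using norm_triangle_ineq4[of "1 / z\<^sup>2" "exp z / (exp z - 1)\<^sup>2"] by linarith
    have "r powr (-3/4) \<le> (1 / 8) powr (-3/4)"
      using r8 by (intro powr_mono2') auto
    also have "(1 / 8 :: real) powr (-3/4) \<le> (1 / 8) powr (-1)"
      by (intro powr_mono') auto
    finally have "r powr (-3/4) \<le> 8" by (simp add: powr_minus)
    hence "r powr (-3/4) * r powr (-5/4) \<le> 8 * r powr (-5/4)" by (intro mult_right_mono) auto
    moreover have "r powr (-5/4) \<ge> 0" by simp
    ultimately have "norm (1 / z\<^sup>2 - exp z / (exp z - 1)\<^sup>2) \<le> 48 * r powr (-5/4)" using le by linarith
    thus ?thesis by (simp add: r_def)
  qed
qed

text \<open>Removes the pole of \<open>1 / (exp z - 1)\<close> at 0. Summed over \<open>m\<close> at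
  \<open>z = m * tau\<close> with weight \<open>1 / m\<close>, the removed part \<open>1 / z\<close>
  produces \<open>pi^2 / (6 tau)\<close>.\<close>

definition bose_remainder :: "complex \<Rightarrow> complex" where
  "bose_remainder z = 1 / (exp z - 1) - 1 / z"

lemma bose_remainder_vertical_diff:
  assumes "r > 0" "\<bar>y\<bar> \<le> r"
  shows   "norm (bose_remainder (Complex r y) - bose_remainder (of_real r)) \<le> 48 * r powr (-5/4) * \<bar>y\<bar>"
proof -
  \<comment> \<open>A vertical segment inside the cone of \<open>bose_derivative_bound\<close>; the
    real part is constant on it, so the derivative bound is uniform.\<close>
  define S where "S = {z. Re z = r \<and> \<bar>Im z\<bar> \<le> r}"
  have "convex S"
  proof -
    have "S = ({z. Re z \<le> r} \<inter> {z. Re z \<ge> r}) \<inter> ({z. Im z \<le> r} \<inter> {z. Im z \<ge> -r})"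
      by (auto simp: S_def)
    thus ?thesis
      by (simp only: convex_Int convex_halfspace_Im_le convex_halfspace_Im_ge
                     convex_halfspace_Re_le convex_halfspace_Re_ge)
  qed
  have "norm (bose_remainder (Complex r y) - bose_remainder (of_real r)) \<le>
          48 * r powr (-5/4) * norm (Complex r y - of_real r)"
  proof (rule field_differentiable_bound[OF \<open>convex S\<close>])
    fix z assume z: "z \<in> S"
    hence "Re z > 0" "z \<noteq> 0" using assms by (auto simp: S_def)
    thus "(bose_remainder has_field_derivative (1 / z\<^sup>2 - exp z / (exp z - 1)\<^sup>2)) (at z within S)"
      unfolding bose_remainder_def using exp_minus_one_neq_0[of z]
      by (auto intro!: derivative_eq_intros simp: power2_eq_square)
    show "norm (1 / z\<^sup>2 - exp z / (exp z - 1)\<^sup>2) \<le> 48 * r powr (-5/4)"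
      using bose_derivative_bound[of z] z assms by (simp add: S_def)
  qed (use assms in \<open>auto simp: S_def\<close>)
  moreover have "Complex r y - of_real r = \<i> * of_real y" by (simp add: complex_eq_iff)
  ultimately show ?thesis by (simp add: norm_mult)
qed

lemma log_partition_gf_sums:
  assumes "Re \<tau> > 0"
  shows "(\<lambda>m. 1 / (exp (of_nat (Suc m) * \<tau>) - 1) / of_nat (Suc m)) sums log_partition_gf \<tau>"
proof -
  have "exp (-\<tau>) ^ Suc m / (1 - exp (-\<tau>) ^ Suc m) = 1 / (exp (of_nat (Suc m) * \<tau>) - 1)" for m
  proof -
    have "exp (-\<tau>) ^ Suc m = inverse (exp (of_nat (Suc m) * \<tau>))"
      by (simp only: exp_minus power_inverse exp_of_nat_mult)
    moreover have "exp (of_nat (Suc m) * \<tau>) - 1 \<noteq> 0"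
      using assms by (intro exp_minus_one_neq_0) (simp del: of_nat_Suc)
    moreover have "inverse E / (1 - inverse E) = 1 / (E - 1)" if "E \<noteq> 0" "E - 1 \<noteq> 0" for E :: complex
      using that by (simp add: divide_simps)
    ultimately show ?thesis by simp
  qed
  moreover have "summable (\<lambda>m. (exp (-\<tau>) ^ Suc m / (1 - exp (-\<tau>) ^ Suc m)) / of_nat (Suc m))"
    using assms by (intro summable_norm_cancel[OF summable_norm_log_partition]) simp
  ultimately show ?thesis
    unfolding log_partition_gf_def log_partition_series_def by (simp add: sums_iff)
qed

lemma inverse_squares_sums_complex:
  fixes \<tau> :: complex
  shows
  "(\<lambda>m. 1 / (of_nat (Suc m) * (of_nat (Suc m) * \<tau>))) sums (of_real (pi\<^sup>2 / 6) / \<tau>)"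
proof -
  have "(\<lambda>m. of_real (1 / real (Suc m) ^ 2) :: complex) sums of_real (pi\<^sup>2 / 6)"
    using inverse_squares_sums by (subst sums_of_real_iff) (simp add: add_ac)
  from sums_divide[OF this, of \<tau>] show ?thesis
    by (simp add: power2_eq_square mult_ac)
qed

text \<open>With \<open>k = Suc m\<close>, the \<open>m\<close>-th term of the difference is at most
  \<open>48 * (k t) powr (-5/4) * |k y| / k\<close>, and the powers of \<open>k\<close> that remain
  are summable. For \<open>y = t powr (3/2) * u\<close> the bound becomes
  \<open>C * t powr (1/4) * |u|\<close>.\<close>

lemma log_partition_gf_vertical_diff:
  obtains C where "\<And>t y. t > 0 \<Longrightarrow> \<bar>y\<bar> \<le> t \<Longrightarrow>
    norm (log_partition_gf (Complex t y) - log_partition_gf (of_real t)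
            - of_real (pi\<^sup>2 / 6) * (1 / Complex t y - 1 / of_real t)) \<le> C * t powr (-5/4) * \<bar>y\<bar>"
proof
  define S where "S = (\<Sum>m. real (Suc m) powr (-5/4))"
  have summ: "summable (\<lambda>m. real (Suc m) powr (-5/4))"
    using summable_Suc_iff[of "\<lambda>m. real m powr (-5/4)"] by (simp add: summable_real_powr_iff)
  fix t y :: real assume ty: "t > 0" "\<bar>y\<bar> \<le> t"
  define d where "d = (\<lambda>m. (bose_remainder (of_nat (Suc m) * Complex t y) - bose_remainder (of_nat (Suc m) * of_real t))
                              / of_nat (Suc m))"
  have "d sums ((log_partition_gf (Complex t y) - of_real (pi\<^sup>2 / 6) / Complex t y)
               - (log_partition_gf (of_real t) - of_real (pi\<^sup>2 / 6) / of_real t))"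
    unfolding d_def bose_remainder_def diff_divide_distrib
    using ty sums_diff[OF sums_diff[OF log_partition_gf_sums[of "Complex t y"] inverse_squares_sums_complex[of "Complex t y"]]
       sums_diff[OF log_partition_gf_sums[of "of_real t"] inverse_squares_sums_complex[of "of_real t"]]]
    by (simp add: mult_ac del: of_nat_Suc)
  then have d: "d sums (log_partition_gf (Complex t y) - log_partition_gf (of_real t)
            - of_real (pi\<^sup>2 / 6) * (1 / Complex t y - 1 / of_real t))"
  proof -
    have "(a - p / x) - (b - p / x') = a - b - p * (1 / x - 1 / x')" for a b p x x' :: complex
      by (simp add: algebra_simps)
    with \<open>d sums _\<close> show ?thesis by metis
  qed
  have bound: "norm (d m) \<le> 48 * t powr (-5/4) * \<bar>y\<bar> * real (Suc m) powr (-5/4)" for m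
  proof -
    define k where "k = real (Suc m)"
    have k: "k > 0" by (simp add: k_def)
    have eq: "of_nat (Suc m) * Complex t y = Complex (k * t) (k * y)"
             "of_nat (Suc m) * of_real t = complex_of_real (k * t)"
      by (auto simp: k_def complex_eq_iff algebra_simps)
    have "norm (d m) = norm (bose_remainder (Complex (k * t) (k * y)) - bose_remainder (of_real (k * t))) / k"
      unfolding d_def eq norm_divide by (simp add: k_def del: of_nat_Suc)
    also have "\<dots> \<le> (48 * (k * t) powr (-5/4) * \<bar>k * y\<bar>) / k"
      using ty k by (intro divide_right_mono bose_remainder_vertical_diff) (auto simp: abs_mult)
    also have "\<dots> = 48 * t powr (-5/4) * \<bar>y\<bar> * k powr (-5/4)"
      using k ty by (simp add: powr_mult abs_mult)
    finally show ?thesis by (simp add: k_def)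
  qed
  have "norm (\<Sum>m. d m) \<le> (\<Sum>m. 48 * t powr (-5/4) * \<bar>y\<bar> * real (Suc m) powr (-5/4))"
    by (intro norm_suminf_le bound summable_mult summ)
  also have "\<dots> = 48 * S * t powr (-5/4) * \<bar>y\<bar>"
    unfolding S_def by (subst suminf_mult[OF summ]) simp
  finally show "norm (log_partition_gf (Complex t y) - log_partition_gf (of_real t)
            - of_real (pi\<^sup>2 / 6) * (1 / Complex t y - 1 / of_real t)) \<le> (48 * S) * t powr (-5/4) * \<bar>y\<bar>"
    using d by (simp add: sums_iff)
qed

section \<open>Decay away from the saddle point\<close>

text \<open>On the real axis all arguments of \<open>Ln\<close> are positive reals. The second claim
  is the hypothesis of \<open>ln1mexp_sum_asymptotics\<close>.\<close>

lemma log_partition_gf_of_real: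
  assumes "t > 0"
  shows   "log_partition_gf (of_real t) = of_real (Re (log_partition_gf (of_real t)))"
    and   "(\<lambda>K. \<Sum>k=1..K. ln1mexp (real k * t)) \<longlonglongrightarrow> - Re (log_partition_gf (of_real t))"
proof -
  have "(\<lambda>K. \<Sum>k=1..K. - Ln (1 - exp (- complex_of_real t) ^ k)) \<longlonglongrightarrow> log_partition_gf (of_real t)"
    unfolding log_partition_gf_def by (rule log_partition_tendsto) (use assms in simp)
  moreover have "- Ln (1 - exp (- complex_of_real t) ^ k) = of_real (- ln1mexp (real k * t))" if "k \<ge> 1" for k
  proof -
    have "exp (- complex_of_real t) ^ k = exp (of_real (- (real k * t)))"
      by (simp flip: exp_of_nat_mult)
    also have "\<dots> = of_real (exp (- (real k * t)))" by (rule exp_of_real)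
    finally have "exp (- complex_of_real t) ^ k = of_real (exp (- (real k * t)))" .
    hence "1 - exp (- complex_of_real t) ^ k = of_real (1 - exp (- (real k * t)))" by simp
    moreover have "1 - exp (- (real k * t)) > 0" using assms that by simp
    ultimately show ?thesis by (simp only: Ln_of_real ln1mexp_def of_real_minus)
  qed
  ultimately have lim: "(\<lambda>K. complex_of_real (\<Sum>k=1..K. - ln1mexp (real k * t))) \<longlonglongrightarrow> log_partition_gf (of_real t)"
    by simp
  from tendsto_Re[OF this] have lim_Re: "(\<lambda>K. \<Sum>k=1..K. - ln1mexp (real k * t)) \<longlonglongrightarrow> Re (log_partition_gf (of_real t))"
    by simp
  from LIMSEQ_unique[OF lim tendsto_of_real[OF this]]
  show "log_partition_gf (of_real t) = of_real (Re (log_partition_gf (of_real t)))" .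
  from tendsto_minus[OF lim_Re] show "(\<lambda>K. \<Sum>k=1..K. ln1mexp (real k * t)) \<longlonglongrightarrow> - Re (log_partition_gf (of_real t))"
    by (simp add: sum_negf)
qed

lemma log_partition_gf_real_asymptotics:
  "((\<lambda>t. Re (log_partition_gf (of_real t)) - pi\<^sup>2 / (6 * t) - ln t / 2) \<longlongrightarrow> - ln (2 * pi) / 2) (at_right 0)"
proof -
  have "((\<lambda>t. - Re (log_partition_gf (of_real t)) + pi\<^sup>2 / (6 * t) + ln t / 2) \<longlongrightarrow> ln (2 * pi) / 2) (at_right 0)"
    by (rule ln1mexp_sum_asymptotics) (rule log_partition_gf_of_real(2))
  from tendsto_minus[OF this] show ?thesis by (simp add: algebra_simps)
qed

text \<open>All terms of the series for \<open>log_partition_gf\<close> are largest on the real axis; the first one alone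
  already accounts for the decay off the axis.\<close>

lemma Re_log_partition_gf_diff_le:
  assumes "t > 0"
  shows   "Re (log_partition_gf (Complex t y)) - Re (log_partition_gf (of_real t))
             \<le> 1 / norm (exp (Complex t y) - 1) - 1 / (exp t - 1)"
proof -
  define a where "a = (\<lambda>m. Re (1 / (exp (of_nat (Suc m) * Complex t y) - 1) / of_nat (Suc m)))"
  define b where "b = (\<lambda>m. 1 / (exp (real (Suc m) * t) - 1) / real (Suc m))"
  have a: "a sums Re (log_partition_gf (Complex t y))"
    unfolding a_def using assms by (intro sums_Re log_partition_gf_sums) simp
  have "(\<lambda>m. Re (1 / (exp (of_nat (Suc m) * of_real t) - 1) / of_nat (Suc m))) sums Re (log_partition_gf (of_real t))"
    using assms by (intro sums_Re log_partition_gf_sums) simp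
  moreover have "1 / (exp (of_nat (Suc m) * of_real t) - 1) / of_nat (Suc m) = complex_of_real (b m)" for m
  proof -
    have "exp (of_nat (Suc m) * of_real t) = complex_of_real (exp (real (Suc m) * t))"
      by (metis exp_of_real of_real_mult of_real_of_nat_eq)
    thus ?thesis unfolding b_def by (simp only: of_real_divide of_real_diff of_real_1 of_real_of_nat_eq)
  qed
  ultimately have b: "b sums Re (log_partition_gf (of_real t))" by (simp only: Re_complex_of_real)
  have norm_a: "\<bar>a m\<bar> \<le> 1 / norm (exp (of_nat (Suc m) * Complex t y) - 1) / real (Suc m)" for m
    unfolding a_def using abs_Re_le_cmod[of "1 / (exp (of_nat (Suc m) * Complex t y) - 1) / of_nat (Suc m)"]
    by (simp only: norm_divide norm_one norm_of_nat)
  have le: "a m \<le> b m" for m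
  proof -
    have "a m \<le> 1 / norm (exp (of_nat (Suc m) * Complex t y) - 1) / real (Suc m)"
      using norm_a[of m] by linarith
    also have "\<dots> \<le> b m"
      unfolding b_def
    proof (intro divide_right_mono divide_left_mono mult_pos_pos)
      show ge: "exp (real (Suc m) * t) - 1 \<le> norm (exp (of_nat (Suc m) * Complex t y) - 1)"
        using norm_exp_minus_one_ge[of "of_nat (Suc m) * Complex t y"] by simp
      show gt: "0 < exp (real (Suc m) * t) - 1" using assms by simp
      show "0 < norm (exp (of_nat (Suc m) * Complex t y) - 1)" using ge gt by linarith
    qed auto
    finally show ?thesis .
  qed
  have d: "(\<lambda>m. b m - a m) sums (Re (log_partition_gf (of_real t)) - Re (log_partition_gf (Complex t y)))"
    by (intro sums_diff a b)
  have "(\<Sum>m\<in>{0}. b m - a m) \<le> (\<Sum>m. b m - a m)"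
    by (rule sum_le_suminf) (use d le in \<open>auto simp: sums_iff\<close>)
  hence "b 0 - a 0 \<le> Re (log_partition_gf (of_real t)) - Re (log_partition_gf (Complex t y))"
    using d by (simp add: sums_iff)
  moreover have "a 0 \<le> 1 / norm (exp (Complex t y) - 1)" using norm_a[of 0] by simp
  moreover have "b 0 = 1 / (exp t - 1)" by (simp add: b_def)
  ultimately show ?thesis by linarith
qed

text \<open>Up to \<open>pi / 3\<close> the function \<open>sin x - x / 2\<close> increases, since
  \<open>cos x >= 1 / 2\<close> there; beyond it \<open>sin y >= sqrt 3 / 2 >= 0.8\<close>, which
  exceeds \<open>pi / 4\<close>.\<close>

lemma sin_ge_half:
  fixes y :: real
  assumes "0 \<le> y" "y \<le> pi / 2"
  shows   "y / 2 \<le> sin y"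
proof (cases "y \<le> pi / 3")
  case True
  have "(\<lambda>x. sin x - x / 2) 0 \<le> (\<lambda>x. sin x - x / 2) y"
  proof (rule DERIV_nonneg_imp_nondecreasing[of 0 y "\<lambda>x. sin x - x / 2"])
    fix x assume x: "0 \<le> x" "x \<le> y"
    have "cos (pi / 3) \<le> cos x" using x True pi_gt_zero by (intro cos_monotone_0_pi_le) auto
    hence "cos x - 1 / 2 \<ge> 0" by (simp add: cos_60)
    moreover have "((\<lambda>x. sin x - x / 2) has_real_derivative (cos x - 1 / 2)) (at x)"
      by (auto intro!: derivative_eq_intros)
    ultimately show "\<exists>d. ((\<lambda>x. sin x - x / 2) has_real_derivative d) (at x) \<and> 0 \<le> d" by blast
  qed (use assms in auto)
  thus ?thesis by simp
next
  case False
  have "sin (pi / 3) \<le> sin y" using False assms pi_gt_zero by (intro sin_monotone_2pi_le) auto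
  moreover have "sqrt 3 \<ge> 1.6" by (rule real_le_rsqrt) (simp add: power2_eq_square)
  moreover have "pi < 3.2" using pi_approx by simp
  ultimately show ?thesis using assms by (simp add: sin_60)
qed

text \<open>The square is exactly \<open>(exp t - 1)^2 + 4 exp t sin(y/2)^2\<close>, and
  \<open>|sin (y / 2)| >= |y| / 4\<close> for \<open>|y| <= pi\<close>.\<close>

lemma norm_exp_minus_one_squared_ge:
  assumes "t \<ge> 0" "\<bar>y\<bar> \<le> pi"
  shows   "(norm (exp (Complex t y) - 1))\<^sup>2 \<ge> (exp t - 1)\<^sup>2 + y\<^sup>2 / 4"
proof -
  have "exp (Complex t y) - 1 = Complex (exp t * cos y - 1) (exp t * sin y)"
    by (simp add: complex_eq_iff Re_exp Im_exp)
  hence "(norm (exp (Complex t y) - 1))\<^sup>2 = (exp t * cos y - 1)\<^sup>2 + (exp t * sin y)\<^sup>2"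
    by (simp add: cmod_power2)
  also have "\<dots> = (exp t)\<^sup>2 * ((sin y)\<^sup>2 + (cos y)\<^sup>2) - 2 * exp t * cos y + 1"
  proof -
    have "(a * c - 1)\<^sup>2 + (a * s)\<^sup>2 = a\<^sup>2 * (s\<^sup>2 + c\<^sup>2) - 2 * a * c + 1" for a c s :: real
      by (simp add: power2_eq_square algebra_simps)
    thus ?thesis .
  qed
  also have "\<dots> = (exp t - 1)\<^sup>2 + 4 * exp t * (sin (y / 2))\<^sup>2"
  proof -
    have c: "cos y = 1 - 2 * (sin (y / 2))\<^sup>2" using cos_double_sin[of "y / 2"] by simp
    show ?thesis unfolding sin_cos_squared_add unfolding c by (simp add: power2_eq_square algebra_simps)
  qed
  finally have eq: "(norm (exp (Complex t y) - 1))\<^sup>2 = (exp t - 1)\<^sup>2 + 4 * exp t * (sin (y / 2))\<^sup>2" .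
  have "(\<bar>y\<bar> / 4)\<^sup>2 \<le> (sin (\<bar>y\<bar> / 2))\<^sup>2"
    using sin_ge_half[of "\<bar>y\<bar> / 2"] assms by (intro power_mono) auto
  also have "(sin (\<bar>y\<bar> / 2))\<^sup>2 = (sin (y / 2))\<^sup>2" by (cases "y \<ge> 0") auto
  finally have "y\<^sup>2 / 16 \<le> (sin (y / 2))\<^sup>2" by (simp add: power2_eq_square)
  hence "4 * 1 * (y\<^sup>2 / 16) \<le> 4 * exp t * (sin (y / 2))\<^sup>2"
    using assms by (intro mult_mono) auto
  thus ?thesis unfolding eq by simp
qed

text \<open>From \<open>(1 - x / y)^2 >= 0\<close>. Passing to squares avoids square roots, since
  the lower bound for the norm is a bound for its square.\<close>

lemma inverse_diff_ge:
  fixes x y :: real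
  assumes "0 < x" "x \<le> y"
  shows   "1 / x - 1 / y \<ge> (1 - x\<^sup>2 / y\<^sup>2) / (2 * x)"
proof -
  have "0 \<le> (1 - x / y)\<^sup>2" by simp
  hence "1 - x\<^sup>2 / y\<^sup>2 \<le> 2 * (1 - x / y)" by (simp add: power2_eq_square algebra_simps)
  hence "(1 - x\<^sup>2 / y\<^sup>2) / (2 * x) \<le> 2 * (1 - x / y) / (2 * x)" using assms by (intro divide_right_mono) auto
  also have "\<dots> = 1 / x - 1 / y" using assms by (simp add: field_simps)
  finally show ?thesis .
qed

text \<open>Insert the bound for \<open>N^2\<close> and then \<open>A <= 2 t\<close>, valid for
  \<open>t <= 1\<close>. For \<open>|y|\<close> up to \<open>t\<close> the resulting exponent has
  order \<open>y^2 / t^3\<close>, Gaussian on the scale \<open>t^(3/2)\<close>; for larger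
  \<open>|y|\<close> it saturates at order \<open>1 / t\<close>.\<close>

lemma Re_log_partition_gf_diff_le':
  assumes t: "0 < t" "t \<le> 1" and y: "\<bar>y\<bar> \<le> pi"
  shows   "Re (log_partition_gf (Complex t y)) - Re (log_partition_gf (of_real t)) \<le> - (y\<^sup>2 / (4 * t * (16 * t\<^sup>2 + y\<^sup>2)))"
proof -
  define A where "A = exp t - 1"
  define N where "N = norm (exp (Complex t y) - 1)"
  have A: "0 < A" "A \<le> 2 * t"
  proof -
    show "0 < A" using t by (simp add: A_def)
    have "exp t \<le> 1 + t + t\<^sup>2" using t by (intro exp_bound) auto
    moreover have "t\<^sup>2 \<le> t" using t by (simp add: power2_eq_square mult_left_le)
    ultimately show "A \<le> 2 * t" by (simp add: A_def)
  qed
  have NA: "A\<^sup>2 + y\<^sup>2 / 4 \<le> N\<^sup>2" unfolding A_def N_def using t y by (intro norm_exp_minus_one_squared_ge) auto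
  have "A\<^sup>2 \<le> N\<^sup>2" using NA by (smt (verit) zero_le_power2 divide_nonneg_pos)
  hence AN: "A \<le> N" by (rule power2_le_imp_le) (simp add: N_def)
  have A2: "A\<^sup>2 + y\<^sup>2 / 4 > 0" using A by (intro add_pos_nonneg) auto
  have "y\<^sup>2 / (4 * t * (16 * t\<^sup>2 + y\<^sup>2)) \<le> y\<^sup>2 / (2 * A * (4 * A\<^sup>2 + y\<^sup>2))"
  proof (rule divide_left_mono)
    have "A\<^sup>2 \<le> (2 * t)\<^sup>2" using A by (intro power_mono) auto
    hence le: "4 * A\<^sup>2 + y\<^sup>2 \<le> 16 * t\<^sup>2 + y\<^sup>2" by simp
    have le': "2 * A \<le> 4 * t" using A by simp
    show "2 * A * (4 * A\<^sup>2 + y\<^sup>2) \<le> 4 * t * (16 * t\<^sup>2 + y\<^sup>2)"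
      by (rule mult_mono[OF le' le]) (use A t in auto)
    show "0 < 4 * t * (16 * t\<^sup>2 + y\<^sup>2) * (2 * A * (4 * A\<^sup>2 + y\<^sup>2))"
      using A t by (auto intro!: mult_pos_pos add_pos_nonneg)
  qed auto
  also have "\<dots> = (1 - A\<^sup>2 / (A\<^sup>2 + y\<^sup>2 / 4)) / (2 * A)"
  proof -
    have "4 * A\<^sup>2 + y\<^sup>2 > 0" using A by (intro add_pos_nonneg) auto
    moreover have "A\<^sup>2 / (A\<^sup>2 + y\<^sup>2 / 4) = 4 * A\<^sup>2 / (4 * A\<^sup>2 + y\<^sup>2)"
      using A2 by (simp add: field_simps)
    ultimately show ?thesis using A by (simp add: field_simps)
  qed
  also have "\<dots> \<le> (1 - A\<^sup>2 / N\<^sup>2) / (2 * A)"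
    using NA A2 A by (intro divide_right_mono diff_left_mono divide_left_mono mult_pos_pos) auto
  also have "\<dots> \<le> 1 / A - 1 / N" by (rule inverse_diff_ge) (use A AN in auto)
  finally show ?thesis using Re_log_partition_gf_diff_le[OF t(1), of y] by (simp add: A_def N_def)
qed

text \<open>With \<open>w = (\<bar>u\<bar> / \<pi>)\<^bsup>1/3\<^esup>\<close>, the constraint \<open>t\<^bsup>3/2\<^esup> \<bar>u\<bar> \<le> \<pi>\<close> says \<open>t \<le> 1 / w\<^sup>2\<close>.\<close>

lemma Re_log_partition_gf_scaled_bound:
  assumes t: "0 < t" "t \<le> 1" and u: "\<bar>t * sqrt t * u\<bar> \<le> pi"
  defines "w \<equiv> root 3 (\<bar>u\<bar> / pi)"
  shows   "Re (log_partition_gf (Complex t (t * sqrt t * u))) - Re (log_partition_gf (of_real t)) \<le> (1 - w\<^sup>2) / 4"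
proof -
  define p where "p = pi\<^sup>2"
  have p: "p \<ge> 9"
  proof -
    have "(3 :: real)\<^sup>2 \<le> pi\<^sup>2" using pi_gt3 by (intro power_mono) auto
    thus ?thesis by (simp add: p_def)
  qed
  have w: "w \<ge> 0" "w ^ 3 = \<bar>u\<bar> / pi" by (auto simp: w_def)
  have u2: "u\<^sup>2 = p * w ^ 6"
  proof -
    have "\<bar>u\<bar> = pi * w ^ 3" using w by simp
    hence "\<bar>u\<bar>\<^sup>2 = (pi * w ^ 3)\<^sup>2" by simp
    thus ?thesis by (simp add: p_def power_mult_distrib flip: power_mult)
  qed
  have y2: "(t * sqrt t * u)\<^sup>2 = t ^ 3 * u\<^sup>2"
    using t by (simp add: power_mult_distrib eval_nat_numeral)
  have "(w\<^sup>2 * t) ^ 3 \<le> 1 ^ 3"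
  proof -
    have "p * (w\<^sup>2 * t) ^ 3 = (t * sqrt t * u)\<^sup>2" unfolding y2 u2
      by (simp add: power_mult_distrib flip: power_mult)
    also have "\<dots> \<le> pi\<^sup>2" using u power_mono[of "\<bar>t * sqrt t * u\<bar>" pi 2] by simp
    finally show ?thesis using p by (simp add: p_def)
  qed
  hence wt: "w\<^sup>2 * t \<le> 1" using t by (subst (asm) power_mono_iff) auto
  have "(w\<^sup>2 - 1) / 4 \<le> (t * sqrt t * u)\<^sup>2 / (4 * t * (16 * t\<^sup>2 + (t * sqrt t * u)\<^sup>2))"
  proof -
    have "(t * sqrt t * u)\<^sup>2 / (4 * t * (16 * t\<^sup>2 + (t * sqrt t * u)\<^sup>2)) = (t ^ 3 * u\<^sup>2) / (t ^ 3 * (4 * (16 + u\<^sup>2 * t)))"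
      unfolding y2 by (simp add: eval_nat_numeral algebra_simps)
    also have "\<dots> = p * w ^ 6 / (4 * (16 + p * w ^ 6 * t))" using t unfolding u2 by simp
    also have "p * w ^ 6 * t = p * w ^ 4 * (w\<^sup>2 * t)" by (simp add: eval_nat_numeral)
    finally have eq: "(t * sqrt t * u)\<^sup>2 / (4 * t * (16 * t\<^sup>2 + (t * sqrt t * u)\<^sup>2)) = p * w ^ 6 / (4 * (16 + p * w ^ 4 * (w\<^sup>2 * t)))" .
    have le: "p * w ^ 4 * (w\<^sup>2 * t) \<le> p * w ^ 4"
      using wt p w by (intro mult_left_le) auto
    have pos: "0 \<le> p * w ^ 4 * (w\<^sup>2 * t)" using p w t by auto
    have "(w\<^sup>2 - 1) * (16 + p * w ^ 4) \<le> p * w ^ 6"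
    proof -
      \<comment> \<open>This is what remains after expanding the product and cancelling
        \<open>p * w ^ 6\<close>. As a quadratic in \<open>w^2\<close> it is a square plus
        \<open>(p - 4) * w ^ 4\<close>, and \<open>p = pi^2 >= 9\<close>.\<close>
      have "16 * w\<^sup>2 \<le> 16 + p * w ^ 4"
      proof -
        have "16 + p * w ^ 4 - 16 * w\<^sup>2 = (4 - 2 * w\<^sup>2)\<^sup>2 + (p - 4) * w ^ 4"
          by (simp add: eval_nat_numeral algebra_simps)
        moreover have "\<dots> \<ge> 0" using p by (intro add_nonneg_nonneg mult_nonneg_nonneg) auto
        ultimately show ?thesis by linarith
      qed
      thus ?thesis by (simp add: eval_nat_numeral algebra_simps)
    qed
    hence "w\<^sup>2 - 1 \<le> p * w ^ 6 / (16 + p * w ^ 4)"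
      using p w by (subst pos_le_divide_eq) (auto intro!: add_pos_nonneg)
    also have "\<dots> \<le> p * w ^ 6 / (16 + p * w ^ 4 * (w\<^sup>2 * t))"
      using le pos p w by (intro divide_left_mono mult_pos_pos add_pos_nonneg add_left_mono) auto
    finally have "w\<^sup>2 - 1 \<le> p * w ^ 6 / (16 + p * w ^ 4 * (w\<^sup>2 * t))" .
    moreover have "a / (4 * b) = a / b / 4" for a b :: real by simp
    ultimately show ?thesis unfolding eq by (metis divide_right_mono zero_le_numeral)
  qed
  moreover have "Re (log_partition_gf (Complex t (t * sqrt t * u))) - Re (log_partition_gf (of_real t)) \<le>
      - ((t * sqrt t * u)\<^sup>2 / (4 * t * (16 * t\<^sup>2 + (t * sqrt t * u)\<^sup>2)))"
    by (rule Re_log_partition_gf_diff_le'[OF t u])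
  ultimately show ?thesis by (simp add: diff_divide_distrib)
qed

text \<open>Where the exponent saturates at order \<open>1 / t\<close>, the constraint
  \<open>t <= 1 / w^2\<close> leaves only decay like \<open>exp (- w^2 / 4)\<close>, a stretched
  exponential in \<open>|u|\<close> with power 2/3. It still beats every polynomial: the factor
  \<open>1 + |u|\<close> makes room for the difference weight, and \<open>1 / (1 + u^2)\<close> is a
  convenient integrable majorant.\<close>

lemma scaled_dominating_function:
  obtains C where "\<And>u :: real. exp ((1 - (root 3 (\<bar>u\<bar> / pi))\<^sup>2) / 4) * (1 + \<bar>u\<bar>) \<le> C * inverse (1 + u\<^sup>2)"
proof -
  define k where "k = (\<lambda>w::real. exp ((1 - w\<^sup>2) / 4) * (1 + pi * w ^ 3) * (1 + (pi * w ^ 3)\<^sup>2))"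
  have "(k \<longlongrightarrow> 0) at_top"
    unfolding k_def by real_asymp
  hence "eventually (\<lambda>w. k w < 1) at_top" by (rule order_tendstoD) simp
  then obtain W where W: "\<And>w. w \<ge> W \<Longrightarrow> k w < 1" unfolding eventually_at_top_linorder by blast
  have "compact (k ` {0..max 0 W})"
    unfolding k_def by (intro compact_continuous_image continuous_intros) auto
  hence "bounded (k ` {0..max 0 W})" by (rule compact_imp_bounded)
  then obtain B where B: "\<And>w. w \<in> {0..max 0 W} \<Longrightarrow> norm (k w) \<le> B" unfolding bounded_iff by blast
  have bound: "k w \<le> max B 1" if "w \<ge> 0" for w
  proof (cases "w \<le> W")
    case True
    thus ?thesis using B[of w] that by (auto simp: max_def split: if_splits)
  next
    case False
    thus ?thesis using W[of w] by auto
  qed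
  show ?thesis
  proof (rule that)
    fix u :: real
    define w where "w = root 3 (\<bar>u\<bar> / pi)"
    have w: "w \<ge> 0" "pi * w ^ 3 = \<bar>u\<bar>" by (auto simp: w_def)
    have "exp ((1 - w\<^sup>2) / 4) * (1 + \<bar>u\<bar>) * (1 + u\<^sup>2) \<le> max B 1"
      using bound[OF w(1)] unfolding k_def w(2) by simp
    moreover have "1 + u\<^sup>2 > 0" by (intro add_pos_nonneg) auto
    ultimately show "exp ((1 - (root 3 (\<bar>u\<bar> / pi))\<^sup>2) / 4) * (1 + \<bar>u\<bar>) \<le> max B 1 * inverse (1 + u\<^sup>2)"
      unfolding w_def [symmetric] by (simp add: pos_le_divide_eq flip: divide_inverse)
  qed
qed

section \<open>Convergence of the saddle point integrals\<close>

lemma Complex_1_neq_0: "Complex 1 x \<noteq> 0"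
  by (metis complex.sel(1) one_neq_zero zero_complex.sel(1))

definition saddle_point :: "nat \<Rightarrow> real" where
  "saddle_point n = pi / sqrt (6 * real n)"

lemma saddle_point_pos: "n > 0 \<Longrightarrow> saddle_point n > 0"
  by (simp add: saddle_point_def)

lemma saddle_point_le_1:
  assumes "n \<ge> 2"
  shows   "saddle_point n \<le> 1"
proof -
  have "pi \<le> sqrt 12"
  proof (rule real_le_rsqrt)
    have "pi\<^sup>2 \<le> (3.2)\<^sup>2" using pi_approx by (intro power_mono) auto
    thus "pi\<^sup>2 \<le> 12" by (simp add: power2_eq_square)
  qed
  also have "\<dots> \<le> sqrt (6 * real n)" using assms by simp
  finally show ?thesis using assms by (simp add: saddle_point_def)
qed

lemma saddle_point_at_right_0: "filterlim saddle_point (at_right 0) sequentially"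
  unfolding saddle_point_def by real_asymp

lemma saddle_point_squared:
  assumes "n > 0"
  shows   "real n = pi\<^sup>2 / (6 * (saddle_point n)\<^sup>2)"
  using assms by (simp add: saddle_point_def power_divide)

text \<open>The integrand in the variable \<open>u\<close>, where \<open>y = t * sqrt t * u\<close>,
  divided by its value \<open>exp (L t + n t)\<close> on the real axis. The indicator carries the
  constraint \<open>|y| <= pi\<close>, so that all integrals extend over the whole line, as
  dominated convergence requires.\<close>

definition saddle_integrand :: "nat \<Rightarrow> real \<Rightarrow> real \<Rightarrow> complex" where
  "saddle_integrand n t u = indicator {-pi..pi} (t * sqrt t * u) *\<^sub>R
     exp (log_partition_gf (Complex t (t * sqrt t * u)) - log_partition_gf (of_real t)
            + \<i> * of_real (real n * (t * sqrt t * u)))"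

text \<open>The substitution contributes \<open>t * sqrt t\<close>. For the second claim, passing
  from \<open>n\<close> to \<open>n + 1\<close> multiplies the integrand by \<open>exp tau\<close>;
  dividing by \<open>t\<close> normalises the weight \<open>exp tau - 1\<close>.\<close>

lemma has_bochner_integral_saddle:
  fixes n :: nat
  assumes t: "t > 0"
  defines "E \<equiv> exp (Re (log_partition_gf (of_real t)) + real n * t)"
  shows "has_bochner_integral lborel (saddle_integrand n t)
           (of_real (2 * pi * real (partition_number n) / (t * sqrt t * E)))" (is ?P)
    and "has_bochner_integral lborel
           (\<lambda>u. (exp (Complex t (t * sqrt t * u)) - 1) / of_real t * saddle_integrand n t u)
           (of_real (2 * pi * (real (partition_number (n + 1)) - real (partition_number n)) / (t * (t * sqrt t * E))))" (is ?Q)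
proof -
  define s where "s = t * sqrt t"
  have s: "s > 0" using t by (simp add: s_def)
  define f where "f = (\<lambda>n x. indicator {-pi..pi} x *\<^sub>R exp (log_partition_gf (Complex t x) + of_nat n * Complex t x))"
  have E: "of_real E = exp (log_partition_gf (of_real t) + of_real (real n * t))"
    unfolding E_def by (subst log_partition_gf_of_real(1)[OF t]) (simp add: exp_add flip: exp_of_real)
  have E0: "E > 0" by (simp add: E_def)
  have f: "f n (s * u) / of_real E = saddle_integrand n t u" for u
  proof -
    have "of_nat n * Complex t (s * u) = of_real (real n * t) + \<i> * of_real (real n * (s * u))"
      by (simp add: complex_eq_iff)
    hence "exp (log_partition_gf (Complex t (s * u)) + of_nat n * Complex t (s * u)) / of_real E
         = exp (log_partition_gf (Complex t (s * u)) - log_partition_gf (of_real t) + \<i> * of_real (real n * (s * u)))"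
      unfolding E exp_diff [symmetric] by (simp add: algebra_simps)
    thus ?thesis unfolding f_def saddle_integrand_def s_def [symmetric] by (simp only: scaleR_conv_of_real times_divide_eq_right [symmetric])
  qed
  have hbi: "has_bochner_integral lborel (\<lambda>u. f m (s * u) / of_real E) (of_real (2 * pi * real (partition_number m) / (s * E)))" for m
  proof -
    define V where "V = complex_of_real (2 * pi * real (partition_number m))"
    have "has_bochner_integral lborel (f m) V"
      using has_bochner_integral_partition_number[OF t] by (simp add: f_def V_def)
    hence "has_bochner_integral lborel (\<lambda>u. f m (0 + s * u)) (V /\<^sub>R \<bar>s\<bar>)"
      using s by (intro lborel_has_bochner_integral_real_affine_iff[of s "f m" V 0, THEN iffD1]) auto
    from has_bochner_integral_divide[OF this, of "of_real E"]
    have "has_bochner_integral lborel (\<lambda>u. f m (s * u) / of_real E) ((V /\<^sub>R \<bar>s\<bar>) / of_real E)" by simp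
    also have "(V /\<^sub>R \<bar>s\<bar>) / of_real E = of_real (2 * pi * real (partition_number m) / (s * E))"
      using s by (simp add: V_def scaleR_conv_of_real divide_inverse mult_ac)
    finally show ?thesis .
  qed
  from hbi[of n] show ?P unfolding f unfolding s_def .
  have f_Suc: "f (n + 1) x = exp (Complex t x) * f n x" for x
    by (simp add: f_def exp_add algebra_simps)
  have "has_bochner_integral lborel (\<lambda>u. (f (n + 1) (s * u) / of_real E - f n (s * u) / of_real E) / of_real t)
          ((of_real (2 * pi * real (partition_number (n + 1)) / (s * E)) - of_real (2 * pi * real (partition_number n) / (s * E))) / of_real t)"
    using hbi by (intro has_bochner_integral_divide has_bochner_integral_diff)
  also have "(\<lambda>u. (f (n + 1) (s * u) / of_real E - f n (s * u) / of_real E) / of_real t) =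
             (\<lambda>u. (exp (Complex t (t * sqrt t * u)) - 1) / of_real t * saddle_integrand n t u)"
    unfolding f_Suc f [symmetric] s_def using t E0 by (simp add: fun_eq_iff field_simps)
  also have "(of_real (2 * pi * real (partition_number (n + 1)) / (s * E)) - of_real (2 * pi * real (partition_number n) / (s * E))) / of_real t
     = complex_of_real (2 * pi * (real (partition_number (n + 1)) - real (partition_number n)) / (t * (s * E)))"
  proof -
    have "(a / b - c / b) / t = (a - c) / (t * b)" for a b c :: real
      by (simp add: diff_divide_distrib mult.commute)
    from this[of "2 * pi * real (partition_number (n + 1))" "s * E" "2 * pi * real (partition_number n)"]
    show ?thesis by (simp only: of_real_diff [symmetric] of_real_divide [symmetric] right_diff_distrib)
  qed
  finally show ?Q by (simp only: s_def)
qed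

text \<open>The exponent is an error \<open>D\<close>, small by
  \<open>log_partition_gf_vertical_diff\<close>, plus the exact contribution \<open>Q\<close> of
  \<open>pi^2 / (6 tau)\<close> and \<open>n i y\<close>. With \<open>tau = t z\<close>,
  \<open>z = 1 + i sqrt t u\<close> and \<open>n = pi^2 / (6 t^2)\<close>, the terms linear in
  \<open>z - 1\<close> cancel and \<open>Q = - (pi^2 / 6) u^2 / z\<close> remains.\<close>

lemma saddle_integrand_tendsto:
  "(\<lambda>n. saddle_integrand n (saddle_point n) u) \<longlonglongrightarrow> of_real (exp (- (pi\<^sup>2 / 6) * u\<^sup>2))"
proof -
  obtain C where C: "\<And>t y. t > 0 \<Longrightarrow> \<bar>y\<bar> \<le> t \<Longrightarrow>
    norm (log_partition_gf (Complex t y) - log_partition_gf (of_real t)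
            - of_real (pi\<^sup>2 / 6) * (1 / Complex t y - 1 / of_real t)) \<le> C * t powr (-5/4) * \<bar>y\<bar>"
    using log_partition_gf_vertical_diff by blast
  define D where "D = (\<lambda>t. log_partition_gf (Complex t (t * sqrt t * u)) - log_partition_gf (of_real t)
            - of_real (pi\<^sup>2 / 6) * (1 / Complex t (t * sqrt t * u) - 1 / of_real t))"
  define Q where "Q = (\<lambda>t. - of_real (pi\<^sup>2 / 6 * u\<^sup>2) / Complex 1 (sqrt t * u))"
  have "((\<lambda>t. sqrt t * \<bar>u\<bar>) \<longlongrightarrow> 0) (at_right 0)"
    by (auto intro!: tendsto_eq_intros)
  hence "eventually (\<lambda>t. sqrt t * \<bar>u\<bar> < 1) (at_right 0)" by (rule order_tendstoD) simp
  hence small: "eventually (\<lambda>t. \<bar>t * sqrt t * u\<bar> \<le> t) (at_right 0)"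
    using eventually_at_right_less[of 0]
    by eventually_elim (simp add: abs_mult mult.assoc mult_left_le)
  have D_lim: "(D \<longlongrightarrow> 0) (at_right 0)"
  proof (rule Lim_null_comparison)
    show "\<forall>\<^sub>F t in at_right 0. norm (D t) \<le> C * t powr (-5/4) * \<bar>t * sqrt t * u\<bar>"
      using small eventually_at_right_less[of 0] unfolding D_def by eventually_elim (rule C)
    show "((\<lambda>t. C * t powr (-5/4) * \<bar>t * sqrt t * u\<bar>) \<longlongrightarrow> 0) (at_right 0)"
    proof -
      have "((\<lambda>t::real. t powr (-5/4) * \<bar>t * sqrt t\<bar>) \<longlongrightarrow> 0) (at_right 0)" by real_asymp
      hence "((\<lambda>t. (C * \<bar>u\<bar>) * (t powr (-5/4) * \<bar>t * sqrt t\<bar>)) \<longlongrightarrow> (C * \<bar>u\<bar>) * 0) (at_right 0)"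
        by (intro tendsto_intros)
      thus ?thesis by (simp add: abs_mult mult_ac)
    qed
  qed
  have Q_lim: "(Q \<longlongrightarrow> - of_real (pi\<^sup>2 / 6 * u\<^sup>2)) (at_right 0)"
  proof -
    have "((\<lambda>t. sqrt t * u) \<longlongrightarrow> 0) (at_right 0)" by (auto intro!: tendsto_eq_intros)
    hence "((\<lambda>t. Complex 1 (sqrt t * u)) \<longlongrightarrow> Complex 1 0) (at_right 0)" by (intro tendsto_Complex tendsto_const)
    hence "(Q \<longlongrightarrow> - of_real (pi\<^sup>2 / 6 * u\<^sup>2) / Complex 1 0) (at_right 0)"
      unfolding Q_def by (intro tendsto_divide tendsto_const Complex_1_neq_0)
    moreover have "Complex 1 0 = 1" by (simp add: Complex_eq)
    ultimately show ?thesis by simp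
  qed
  have "((\<lambda>t. exp (D t + Q t)) \<longlongrightarrow> exp (0 - of_real (pi\<^sup>2 / 6 * u\<^sup>2))) (at_right 0)"
    using tendsto_add[OF D_lim Q_lim] by (intro tendsto_exp) simp
  from filterlim_compose[OF this saddle_point_at_right_0]
  have lim: "(\<lambda>n. exp (D (saddle_point n) + Q (saddle_point n))) \<longlonglongrightarrow> of_real (exp (- (pi\<^sup>2 / 6) * u\<^sup>2))"
    by (simp flip: exp_of_real)
  have "\<forall>\<^sub>F n in sequentially. \<bar>saddle_point n * sqrt (saddle_point n) * u\<bar> \<le> saddle_point n"
    using small saddle_point_at_right_0 by (rule eventually_compose_filterlim)
  hence "\<forall>\<^sub>F n in sequentially. exp (D (saddle_point n) + Q (saddle_point n)) = saddle_integrand n (saddle_point n) u"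
    using eventually_ge_at_top[of 2]
  proof eventually_elim
    case (elim n)
    define t where "t = saddle_point n"
    define y where "y = t * sqrt t * u"
    have t: "0 < t" "t \<le> 1" using elim saddle_point_pos[of n] saddle_point_le_1[of n] by (auto simp: t_def)
    have n: "real n = pi\<^sup>2 / (6 * t\<^sup>2)" using saddle_point_squared[of n] elim by (simp add: t_def)
    have "\<bar>y\<bar> \<le> pi" using elim t pi_gt3 by (simp add: y_def t_def)
    hence "saddle_integrand n t u = exp (log_partition_gf (Complex t y) - log_partition_gf (of_real t) + \<i> * of_real (real n * y))"
      unfolding saddle_integrand_def y_def [symmetric] by (simp add: indicator_def abs_le_iff)
    also have "log_partition_gf (Complex t y) - log_partition_gf (of_real t) + \<i> * of_real (real n * y) =
                 D t + (of_real (pi\<^sup>2 / 6) * (1 / Complex t y - 1 / of_real t) + \<i> * of_real (real n * y))"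
      by (simp add: D_def y_def)
    also have "of_real (pi\<^sup>2 / 6) * (1 / Complex t y - 1 / of_real t) + \<i> * of_real (real n * y) = Q t"
    proof -
      define z where "z = Complex 1 (sqrt t * u)"
      \<comment> \<open>In terms of \<open>r\<close> all quantities are rational, which puts the
        identity within reach of \<open>field_simps\<close>.\<close>
      define r where "r = complex_of_real (sqrt t)"
      have r: "complex_of_real t = r\<^sup>2" using t by (simp add: r_def flip: of_real_power)
      have r0: "r \<noteq> 0" using t by (simp add: r_def)
      have z: "z = 1 + \<i> * r * of_real u" by (simp add: z_def r_def complex_eq_iff)
      have z0: "z \<noteq> 0" unfolding z_def by (rule Complex_1_neq_0)
      have zt: "Complex t y = r\<^sup>2 * z" unfolding r [symmetric] by (simp add: z_def y_def complex_eq_iff)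
      have iy: "\<i> * of_real y = r\<^sup>2 * (z - 1)" unfolding r [symmetric] z by (simp add: y_def r_def)
      have "\<i> * of_real (real n * y) = of_real (real n) * (\<i> * of_real y)" by simp
      also have "\<dots> = of_real (pi\<^sup>2 / 6) * (z - 1) / r\<^sup>2"
        unfolding iy n using r0 by (simp add: r field_simps power2_eq_square)
      finally have "of_real (pi\<^sup>2 / 6) * (1 / Complex t y - 1 / of_real t) + \<i> * of_real (real n * y) =
              of_real (pi\<^sup>2 / 6) * ((1 / (r\<^sup>2 * z) - 1 / r\<^sup>2) + (z - 1) / r\<^sup>2)"
        unfolding zt r by (simp add: algebra_simps)
      also have "(1 / (r\<^sup>2 * z) - 1 / r\<^sup>2) + (z - 1) / r\<^sup>2 = (z - 1)\<^sup>2 / (r\<^sup>2 * z)"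
        using r0 z0 by (simp add: field_simps power2_eq_square)
      also have "(z - 1)\<^sup>2 = - (r\<^sup>2 * of_real (u\<^sup>2))"
        unfolding z by (simp add: power_mult_distrib)
      also have "- (r\<^sup>2 * of_real (u\<^sup>2)) / (r\<^sup>2 * z) = - of_real (u\<^sup>2) / z"
        using r0 by simp
      also have "of_real (pi\<^sup>2 / 6) * (- of_real (u\<^sup>2) / z) = Q t"
        by (simp add: Q_def z_def)
      finally show ?thesis .
    qed
    finally show ?case by (simp add: t_def)
  qed
  from Lim_transform_eventually[OF lim this] show ?thesis .
qed

lemma gaussian_integral: "integral\<^sup>L lborel (\<lambda>u. of_real (exp (- (pi\<^sup>2 / 6) * u\<^sup>2))) = complex_of_real (sqrt (6 / pi))"
proof -
  \<comment> \<open>The standard deviation \<open>sqrt 3 / pi\<close> solves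
    \<open>1 / (2 sigma^2) = pi^2 / 6\<close>.\<close>
  have "exp (- (pi\<^sup>2 / 6) * u\<^sup>2) = sqrt (6 / pi) * normal_density 0 (sqrt 3 / pi) u" for u
  proof -
    have "sqrt (2 * pi * (sqrt 3 / pi)\<^sup>2) = sqrt (6 / pi)" by (simp add: power_divide power2_eq_square)
    moreover have "- (u - 0)\<^sup>2 / (2 * (sqrt 3 / pi)\<^sup>2) = - (pi\<^sup>2 / 6) * u\<^sup>2" by (simp add: power_divide)
    ultimately show ?thesis unfolding normal_density_def by simp
  qed
  hence "integral\<^sup>L lborel (\<lambda>u. of_real (exp (- (pi\<^sup>2 / 6) * u\<^sup>2))) =
           complex_of_real (integral\<^sup>L lborel (\<lambda>u. sqrt (6 / pi) * normal_density 0 (sqrt 3 / pi) u))"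
    by (simp only: integral_complex_of_real)
  also have "integral\<^sup>L lborel (\<lambda>u. sqrt (6 / pi) * normal_density 0 (sqrt 3 / pi) u) = sqrt (6 / pi)"
    by (subst integral_mult_right_zero) simp
  finally show ?thesis .
qed

lemma norm_saddle_integrand_le:
  assumes "0 < t" "t \<le> 1"
  shows   "norm (saddle_integrand n t u) \<le> exp ((1 - (root 3 (\<bar>u\<bar> / pi))\<^sup>2) / 4)"
proof (cases "\<bar>t * sqrt t * u\<bar> \<le> pi")
  case True
  have "norm (saddle_integrand n t u) \<le>
          exp (Re (log_partition_gf (Complex t (t * sqrt t * u))) - Re (log_partition_gf (of_real t)))"
    using True by (simp add: saddle_integrand_def indicator_def abs_le_iff)
  also have "\<dots> \<le> exp ((1 - (root 3 (\<bar>u\<bar> / pi))\<^sup>2) / 4)"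
    using Re_log_partition_gf_scaled_bound[OF assms True] by simp
  finally show ?thesis .
next
  case False
  hence "t * sqrt t * u \<notin> {-pi..pi}" by auto
  thus ?thesis by (simp add: saddle_integrand_def)
qed

lemma norm_exp_minus_one_le:
  fixes z :: complex
  assumes "0 \<le> Re z" "Re z \<le> 1"
  shows   "norm (exp z - 1) \<le> 3 * norm z"
proof -
  have "norm (exp z - (\<Sum>k\<le>0. z ^ k / fact k)) \<le> exp \<bar>Re z\<bar> * norm z ^ Suc 0 / fact 0"
    by (rule Taylor_exp)
  hence "norm (exp z - 1) \<le> exp (Re z) * norm z" using assms by simp
  also have "exp (Re z) \<le> 3"
  proof -
    have "exp (Re z) \<le> exp 1" using assms by simp
    also have "\<dots> \<le> 3" using exp_le by simp
    finally show ?thesis .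
  qed
  finally show ?thesis by (simp add: mult_right_mono)
qed

lemma norm_difference_weight_le:
  assumes "0 < t" "t \<le> 1"
  shows   "norm ((exp (Complex t (t * sqrt t * u)) - 1) / of_real t) \<le> 3 * (1 + \<bar>u\<bar>)"
proof -
  have "norm (exp (Complex t (t * sqrt t * u)) - 1) \<le> 3 * norm (Complex t (t * sqrt t * u))"
    using assms by (intro norm_exp_minus_one_le) auto
  also have "norm (Complex t (t * sqrt t * u)) \<le> t + t * (sqrt t * \<bar>u\<bar>)"
    using cmod_le[of "Complex t (t * sqrt t * u)"] assms by (simp add: abs_mult mult_ac)
  also have "sqrt t * \<bar>u\<bar> \<le> 1 * \<bar>u\<bar>" using assms by (intro mult_right_mono) auto
  finally have "norm (exp (Complex t (t * sqrt t * u)) - 1) \<le> 3 * (t + t * (1 * \<bar>u\<bar>))"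
    using assms by simp
  thus ?thesis using assms by (simp add: norm_divide divide_le_eq algebra_simps)
qed

text \<open>Split into \<open>(exp w - 1) / w\<close> and \<open>w / t\<close> with
  \<open>w = t * (1 + i sqrt t u)\<close>; both factors tend to 1.\<close>

lemma difference_weight_tendsto:
  "(\<lambda>n. (exp (Complex (saddle_point n) (saddle_point n * sqrt (saddle_point n) * u)) - 1) / of_real (saddle_point n)) \<longlonglongrightarrow> 1"
proof -
  define z where "z = (\<lambda>t. Complex t (t * sqrt t * u))"
  have "((\<lambda>w::complex. (exp w - 1) / w) \<longlongrightarrow> 1) (at 0)"
    using DERIV_exp[of "0 :: complex"] by (simp add: has_field_derivative_iff)
  moreover have "filterlim z (at 0) (at_right 0)"
    unfolding filterlim_at
  proof
    show "\<forall>\<^sub>F t in at_right 0. z t \<in> UNIV \<and> z t \<noteq> 0"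
      using eventually_at_right_less[of 0] by eventually_elim (auto simp: z_def complex_eq_iff)
    have "((\<lambda>t. t * sqrt t * u) \<longlongrightarrow> 0) (at_right 0)" by real_asymp
    hence "(z \<longlongrightarrow> Complex 0 0) (at_right 0)" unfolding z_def by (intro tendsto_Complex tendsto_ident_at)
    thus "(z \<longlongrightarrow> 0) (at_right 0)" by (simp add: complex_eq_iff zero_complex.code)
  qed
  ultimately have lim1: "((\<lambda>t. (exp (z t) - 1) / z t) \<longlongrightarrow> 1) (at_right 0)"
    by (rule filterlim_compose)
  have "((\<lambda>t. sqrt t * u) \<longlongrightarrow> 0) (at_right 0)" by real_asymp
  hence "((\<lambda>t. Complex 1 (sqrt t * u)) \<longlongrightarrow> Complex 1 0) (at_right 0)" by (intro tendsto_Complex tendsto_const)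
  moreover have "Complex 1 0 = 1" by (simp add: Complex_eq)
  ultimately have "((\<lambda>t. (exp (z t) - 1) / z t * Complex 1 (sqrt t * u)) \<longlongrightarrow> 1 * 1) (at_right 0)"
    using lim1 by (intro tendsto_mult) auto
  moreover have "\<forall>\<^sub>F t in at_right 0. (exp (z t) - 1) / z t * Complex 1 (sqrt t * u) = (exp (z t) - 1) / of_real t"
    using eventually_at_right_less[of 0]
  proof eventually_elim
    case (elim t)
    have "z t = of_real t * Complex 1 (sqrt t * u)" by (simp add: z_def complex_eq_iff)
    moreover have "Complex 1 (sqrt t * u) \<noteq> 0" by (rule Complex_1_neq_0)
    ultimately show ?case using elim by simp
  qed
  ultimately have "((\<lambda>t. (exp (z t) - 1) / of_real t) \<longlongrightarrow> 1 * 1) (at_right 0)"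
    by (rule Lim_transform_eventually)
  from filterlim_compose[OF this saddle_point_at_right_0] show ?thesis by (simp add: z_def)
qed

lemma weighted_saddle_integral_tendsto:
  fixes \<omega> :: "nat \<Rightarrow> real \<Rightarrow> complex"
  assumes bound: "\<And>n u. n \<ge> 2 \<Longrightarrow> norm (\<omega> n u) \<le> 3 * (1 + \<bar>u\<bar>)"
    and lim: "\<And>u. (\<lambda>n. \<omega> n u) \<longlonglongrightarrow> 1"
    and I: "\<And>n. n \<ge> 2 \<Longrightarrow> has_bochner_integral lborel (\<lambda>u. \<omega> n u * saddle_integrand n (saddle_point n) u) (of_real (I n))"
  shows "I \<longlonglongrightarrow> sqrt (6 / pi)"
proof -
  obtain C where C: "\<And>u :: real. exp ((1 - (root 3 (\<bar>u\<bar> / pi))\<^sup>2) / 4) * (1 + \<bar>u\<bar>) \<le> C * inverse (1 + u\<^sup>2)"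
    using scaled_dominating_function by blast
  \<comment> \<open>The shift by 2 makes every member of the sequence dominated: the bounds require
    \<open>saddle_point n <= 1\<close>, which fails at \<open>n = 1\<close>.\<close>
  define f where "f = (\<lambda>n u. \<omega> (n + 2) u * saddle_integrand (n + 2) (saddle_point (n + 2)) u)"
  have f: "has_bochner_integral lborel (f n) (of_real (I (n + 2)))" for n
    unfolding f_def by (rule I) simp
  have "(\<lambda>n. integral\<^sup>L lborel (f n)) \<longlonglongrightarrow> integral\<^sup>L lborel (\<lambda>u. complex_of_real (exp (- (pi\<^sup>2 / 6) * u\<^sup>2)))"
  proof (rule integral_dominated_convergence[where w = "\<lambda>u. 3 * C * inverse (1 + u\<^sup>2)"])
    show "f n \<in> borel_measurable lborel" for n using f borel_measurable_has_bochner_integral by blast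
    have "integrable lborel (\<lambda>u::real. inverse (1 + u\<^sup>2))"
      using integrable_inverse_1_plus_square by (simp add: set_integrable_def)
    thus "integrable lborel (\<lambda>u::real. 3 * C * inverse (1 + u\<^sup>2))" by (rule integrable_mult_right)
    show "AE u in lborel. (\<lambda>n. f n u) \<longlonglongrightarrow> complex_of_real (exp (- (pi\<^sup>2 / 6) * u\<^sup>2))"
    proof (rule AE_I2)
      fix u :: real
      have "(\<lambda>n. \<omega> n u * saddle_integrand n (saddle_point n) u) \<longlonglongrightarrow> 1 * complex_of_real (exp (- (pi\<^sup>2 / 6) * u\<^sup>2))"
        by (intro tendsto_mult lim saddle_integrand_tendsto)
      from LIMSEQ_ignore_initial_segment[OF this, of 2]
      show "(\<lambda>n. f n u) \<longlonglongrightarrow> complex_of_real (exp (- (pi\<^sup>2 / 6) * u\<^sup>2))" by (simp add: f_def)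
    qed
    show "AE u in lborel. norm (f n u) \<le> 3 * C * inverse (1 + u\<^sup>2)" for n
    proof (rule AE_I2)
      fix u :: real
      have "norm (f n u) \<le> 3 * (1 + \<bar>u\<bar>) * exp ((1 - (root 3 (\<bar>u\<bar> / pi))\<^sup>2) / 4)"
        unfolding f_def norm_mult
        by (intro mult_mono bound norm_saddle_integrand_le saddle_point_pos saddle_point_le_1) auto
      thus "norm (f n u) \<le> 3 * C * inverse (1 + u\<^sup>2)" using C[of u] by (simp add: algebra_simps)
    qed
  qed simp
  hence "(\<lambda>n. complex_of_real (I (n + 2))) \<longlonglongrightarrow> complex_of_real (sqrt (6 / pi))"
    by (simp only: f [THEN has_bochner_integral_integral_eq] gaussian_integral)
  hence "(\<lambda>n. I (n + 2)) \<longlonglongrightarrow> sqrt (6 / pi)" by (simp only: tendsto_of_real_iff)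
  thus ?thesis by (rule LIMSEQ_offset)
qed

section \<open>Asymptotics\<close>

text \<open>At the saddle point \<open>n t\<close> equals \<open>pi^2 / (6 t)\<close>, the main term
  of \<open>L t\<close>; together they give \<open>pi^2 / (3 t) = pi sqrt (2n/3)\<close>. The factor
  \<open>sqrt t\<close> comes from the term \<open>ln t / 2\<close> of \<open>L t\<close>.\<close>

lemma exp_log_partition_gf_saddle:
  "(\<lambda>n. exp (Re (log_partition_gf (of_real (saddle_point n))) + real n * saddle_point n)
          / (sqrt (saddle_point n) * exp (pi * sqrt (2 * real n / 3)))) \<longlonglongrightarrow> 1 / sqrt (2 * pi)"
proof -
  have "((\<lambda>t. exp (Re (log_partition_gf (of_real t)) - pi\<^sup>2 / (6 * t) - ln t / 2)) \<longlongrightarrow> exp (- ln (2 * pi) / 2)) (at_right 0)"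
    by (intro tendsto_exp log_partition_gf_real_asymptotics)
  moreover have "exp (- ln (2 * pi) / 2) = 1 / sqrt (2 * pi)"
  proof -
    have "exp (- ln (2 * pi) / 2) = exp (- ln (sqrt (2 * pi)))" by (subst ln_sqrt) auto
    also have "\<dots> = 1 / sqrt (2 * pi)" by (subst exp_minus, subst exp_ln) (auto simp: divide_inverse)
    finally show ?thesis .
  qed
  ultimately have "((\<lambda>t. exp (Re (log_partition_gf (of_real t)) - pi\<^sup>2 / (6 * t) - ln t / 2)) \<longlongrightarrow> 1 / sqrt (2 * pi)) (at_right 0)"
    by simp
  from filterlim_compose[OF this saddle_point_at_right_0]
  have lim: "(\<lambda>n. exp (Re (log_partition_gf (of_real (saddle_point n))) - pi\<^sup>2 / (6 * saddle_point n) - ln (saddle_point n) / 2))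
          \<longlonglongrightarrow> 1 / sqrt (2 * pi)" .
  have "\<forall>\<^sub>F n in sequentially. exp (Re (log_partition_gf (of_real (saddle_point n))) - pi\<^sup>2 / (6 * saddle_point n) - ln (saddle_point n) / 2)
         = exp (Re (log_partition_gf (of_real (saddle_point n))) + real n * saddle_point n)
          / (sqrt (saddle_point n) * exp (pi * sqrt (2 * real n / 3)))"
    using eventually_gt_at_top[of 0]
  proof eventually_elim
    case (elim n)
    define t where "t = saddle_point n"
    have t: "t > 0" using saddle_point_pos[OF elim] by (simp add: t_def)
    have nt: "real n * t = pi\<^sup>2 / (6 * t)"
      using t by (subst saddle_point_squared[OF elim], fold t_def) (simp add: power2_eq_square)
    have "sqrt (6 * real n) = 3 * sqrt (2 * real n / 3)"
    proof -
      have "sqrt (6 * real n) = sqrt (3\<^sup>2 * (2 * real n / 3))" by simp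
      also have "\<dots> = 3 * sqrt (2 * real n / 3)" by (subst real_sqrt_mult) simp
      finally show ?thesis .
    qed
    hence "pi * sqrt (2 * real n / 3) = pi\<^sup>2 / (3 * t)"
      using elim by (simp add: t_def saddle_point_def power2_eq_square)
    hence R: "pi * sqrt (2 * real n / 3) = 2 * (pi\<^sup>2 / (6 * t))" by simp
    have s: "sqrt t = exp (ln t / 2)" using t by (simp flip: ln_sqrt)
    show ?case
      unfolding t_def [symmetric] nt R s exp_add [symmetric] exp_diff [symmetric]
      by (simp add: algebra_simps)
  qed
  from Lim_transform_eventually[OF lim this] show ?thesis .
qed

lemma saddle_constant: "sqrt (6 / pi) * (1 / sqrt (2 * pi)) = sqrt 3 / pi"
proof -
  have "sqrt (6 / pi) * (1 / sqrt (2 * pi)) = sqrt ((6 / pi) / (2 * pi))"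
    by (simp only: real_sqrt_divide) simp
  also have "(6 / pi) / (2 * pi) = 3 / pi\<^sup>2" by (simp add: power2_eq_square)
  also have "sqrt (3 / pi\<^sup>2) = sqrt 3 / pi" by (simp add: real_sqrt_divide)
  finally show ?thesis .
qed

lemma partition_number_saddle_limit:
  "(\<lambda>n. 2 * pi * real (partition_number n) / ((saddle_point n)\<^sup>2 * exp (pi * sqrt (2 * real n / 3)))) \<longlonglongrightarrow> sqrt 3 / pi"
  "(\<lambda>n. 2 * pi * (real (partition_number (n + 1)) - real (partition_number n))
          / ((saddle_point n) ^ 3 * exp (pi * sqrt (2 * real n / 3)))) \<longlonglongrightarrow> sqrt 3 / pi"
proof -
  define t where "t = saddle_point"
  define E where "E = (\<lambda>n. exp (Re (log_partition_gf (of_real (t n))) + real n * t n))"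
  define R where "R = (\<lambda>n. exp (pi * sqrt (2 * real n / 3)))"
  have pos: "t n > 0" if "n \<ge> 2" for n using that saddle_point_pos[of n] by (simp add: t_def)
  have ER: "(\<lambda>n. E n / (sqrt (t n) * R n)) \<longlonglongrightarrow> 1 / sqrt (2 * pi)"
    unfolding E_def t_def R_def by (rule exp_log_partition_gf_saddle)
  \<comment> \<open>Replaces \<open>E n\<close> by the explicit \<open>sqrt (t n) * R n\<close>. The
    additional square root turns the powers \<open>t^(3/2)\<close> and \<open>t^(5/2)\<close> into
    \<open>t^2\<close> and \<open>t^3\<close>.\<close>
  have *: "(\<lambda>n. a n / (c n * R n)) \<longlonglongrightarrow> sqrt 3 / pi"
    if lim: "(\<lambda>n. a n / (b n * E n)) \<longlonglongrightarrow> sqrt (6 / pi)"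
      and c: "\<And>n. n \<ge> 2 \<Longrightarrow> c n = b n * sqrt (t n)" for a b c :: "nat \<Rightarrow> real"
  proof -
    have lim': "(\<lambda>n. a n / (b n * E n) * (E n / (sqrt (t n) * R n))) \<longlonglongrightarrow> sqrt 3 / pi"
      using tendsto_mult[OF lim ER] by (simp only: saddle_constant)
    have "\<forall>\<^sub>F n in sequentially. a n / (b n * E n) * (E n / (sqrt (t n) * R n)) = a n / (c n * R n)"
      using eventually_ge_at_top[of 2]
    proof eventually_elim
      case (elim n)
      have "E n \<noteq> 0" by (simp add: E_def)
      thus ?case using c[OF elim] by simp
    qed
    from Lim_transform_eventually[OF lim' this] show ?thesis .
  qed
  have "(\<lambda>n. 2 * pi * real (partition_number n) / ((t n * sqrt (t n)) * E n)) \<longlonglongrightarrow> sqrt (6 / pi)"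
  proof (rule weighted_saddle_integral_tendsto[of "\<lambda>_ _. 1"])
    fix n :: nat assume "n \<ge> 2"
    thus "has_bochner_integral lborel (\<lambda>u. 1 * saddle_integrand n (saddle_point n) u)
            (of_real (2 * pi * real (partition_number n) / ((t n * sqrt (t n)) * E n)))"
      using has_bochner_integral_saddle(1)[OF pos[of n], of n] unfolding E_def t_def by simp
  qed auto
  from *[OF this, of "\<lambda>n. (t n)\<^sup>2"]
  show "(\<lambda>n. 2 * pi * real (partition_number n) / ((saddle_point n)\<^sup>2 * exp (pi * sqrt (2 * real n / 3)))) \<longlonglongrightarrow> sqrt 3 / pi"
    using pos unfolding R_def t_def by (simp add: power2_eq_square less_imp_le)
  have "(\<lambda>n. 2 * pi * (real (partition_number (n + 1)) - real (partition_number n)) / ((t n * (t n * sqrt (t n))) * E n)) \<longlonglongrightarrow> sqrt (6 / pi)"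
  proof (rule weighted_saddle_integral_tendsto)
    fix n :: nat assume "n \<ge> 2"
    thus "has_bochner_integral lborel
            (\<lambda>u. (exp (Complex (t n) (t n * sqrt (t n) * u)) - 1) / of_real (t n) * saddle_integrand n (saddle_point n) u)
            (of_real (2 * pi * (real (partition_number (n + 1)) - real (partition_number n)) / ((t n * (t n * sqrt (t n))) * E n)))"
      using has_bochner_integral_saddle(2)[OF pos[of n], of n] unfolding E_def t_def by (simp add: mult.assoc)
  next
    fix n :: nat and u :: real assume "n \<ge> 2"
    thus "norm ((exp (Complex (t n) (t n * sqrt (t n) * u)) - 1) / of_real (t n)) \<le> 3 * (1 + \<bar>u\<bar>)"
      unfolding t_def by (intro norm_difference_weight_le saddle_point_pos saddle_point_le_1) auto
  next
    fix u :: real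
    show "(\<lambda>n. (exp (Complex (t n) (t n * sqrt (t n) * u)) - 1) / of_real (t n)) \<longlonglongrightarrow> 1"
      unfolding t_def by (rule difference_weight_tendsto)
  qed
  from *[OF this, of "\<lambda>n. (t n) ^ 3"]
  show "(\<lambda>n. 2 * pi * (real (partition_number (n + 1)) - real (partition_number n))
          / ((saddle_point n) ^ 3 * exp (pi * sqrt (2 * real n / 3)))) \<longlonglongrightarrow> sqrt 3 / pi"
    using pos unfolding R_def t_def by (simp add: power3_eq_cube less_imp_le mult.assoc)
qed

lemma hardy_ramanujan:
  "(\<lambda>n. real (partition_number n)) \<sim>[at_top] (\<lambda>n. exp (pi * sqrt (2 * real n / 3)) / (4 * sqrt 3 * real n))"
proof (rule asymp_equivI')
  have lim: "(\<lambda>n. 2 * pi * real (partition_number n) / ((saddle_point n)\<^sup>2 * exp (pi * sqrt (2 * real n / 3))) * (pi / sqrt 3))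
          \<longlonglongrightarrow> sqrt 3 / pi * (pi / sqrt 3)"
    by (intro tendsto_mult tendsto_const partition_number_saddle_limit)
  have "\<forall>\<^sub>F n in sequentially.
      2 * pi * real (partition_number n) / ((saddle_point n)\<^sup>2 * exp (pi * sqrt (2 * real n / 3))) * (pi / sqrt 3)
        = real (partition_number n) / (exp (pi * sqrt (2 * real n / 3)) / (4 * sqrt 3 * real n))"
    using eventually_gt_at_top[of 0]
  proof eventually_elim
    case (elim n)
    have sp: "(saddle_point n)\<^sup>2 = pi\<^sup>2 / (6 * real n)" by (simp add: saddle_point_def power_divide)
    have "2 * pi * P / (pi\<^sup>2 / (6 * N) * R) * (pi / s) = P / (R / (4 * s * N))"
      if "s * s = 3" "s > 0" "N > 0" "R > 0" for s N P R :: real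
    proof -
      have "12 / s = 4 * s" using that by (simp add: field_simps)
      moreover have "2 * pi * P / (pi\<^sup>2 / (6 * N) * R) * (pi / s) = 12 / s * (N * P / R)"
        using that by (simp add: field_simps power2_eq_square)
      ultimately show ?thesis by simp
    qed
    thus ?case unfolding sp using elim by simp
  qed
  from Lim_transform_eventually[OF lim this]
  show "(\<lambda>n. real (partition_number n) / (exp (pi * sqrt (2 * real n / 3)) / (4 * sqrt 3 * real n))) \<longlonglongrightarrow> 1"
    by simp
qed

lemma partition_number_difference_asymptotics:
  "(\<lambda>n. real (partition_number (n + 1)) - real (partition_number n))
     \<sim>[at_top] (\<lambda>n. pi / (12 * sqrt 2 * real n powr (3 / 2)) * exp (pi * sqrt (2 * real n / 3)))"
proof (rule asymp_equivI')
  have lim: "(\<lambda>n. 2 * pi * (real (partition_number (n + 1)) - real (partition_number n))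
           / ((saddle_point n) ^ 3 * exp (pi * sqrt (2 * real n / 3))) * (pi / sqrt 3))
          \<longlonglongrightarrow> sqrt 3 / pi * (pi / sqrt 3)"
    by (intro tendsto_mult tendsto_const partition_number_saddle_limit)
  have "\<forall>\<^sub>F n in sequentially.
      2 * pi * (real (partition_number (n + 1)) - real (partition_number n))
           / ((saddle_point n) ^ 3 * exp (pi * sqrt (2 * real n / 3))) * (pi / sqrt 3)
        = (real (partition_number (n + 1)) - real (partition_number n))
           / (pi / (12 * sqrt 2 * real n powr (3 / 2)) * exp (pi * sqrt (2 * real n / 3)))"
    using eventually_gt_at_top[of 0]
  proof eventually_elim
    case (elim n)
    define D where "D = real (partition_number (n + 1)) - real (partition_number n)"
    define R where "R = exp (pi * sqrt (2 * real n / 3))"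
    define p where "p = real n powr (3 / 2)"
    have p: "p = real n * sqrt (real n)"
    proof -
      have "p = real n powr 1 * real n powr (1 / 2)" unfolding p_def by (subst powr_add [symmetric]) simp
      thus ?thesis using elim by (simp add: powr_half_sqrt)
    qed
    have "sqrt (6 * real n) = sqrt 3 * (sqrt 2 * sqrt (real n))"
      by (simp flip: real_sqrt_mult)
    moreover have "sqrt (6 * real n) ^ 3 = 6 * real n * sqrt (6 * real n)"
      by (simp add: power3_eq_cube)
    ultimately have "sqrt (6 * real n) ^ 3 = 6 * sqrt 3 * sqrt 2 * p"
      unfolding p by simp
    hence sp: "(saddle_point n) ^ 3 = pi ^ 3 / (6 * sqrt 3 * sqrt 2 * p)"
      by (simp add: saddle_point_def power_divide)
    have "p > 0" "R > 0" using elim by (auto simp: p_def R_def)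
    hence "2 * pi * D / ((saddle_point n) ^ 3 * R) * (pi / sqrt 3) = D / (pi / (12 * sqrt 2 * p) * R)"
      unfolding sp by (simp add: field_simps power3_eq_cube)
    thus ?case by (simp only: D_def R_def p_def)
  qed
  from Lim_transform_eventually[OF lim this]
  show "(\<lambda>n. (real (partition_number (n + 1)) - real (partition_number n))
           / (pi / (12 * sqrt 2 * real n powr (3 / 2)) * exp (pi * sqrt (2 * real n / 3)))) \<longlonglongrightarrow> 1"
    by simp
qed

theorem theorem4p1:
  shows "(\<lambda>n::nat. real_of_int (partition_G n))
           \<sim>[at_top] (\<lambda>n. pi / sqrt (6 * real n) * real (partition_number n)) \<and>
         (\<lambda>n::nat. real_of_int (partition_G n))
           \<sim>[at_top] (\<lambda>n. pi / (12 * sqrt 2 * real n powr (3 / 2)) * exp (pi * sqrt (2 * real n / 3))) \<and>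
         (\<lambda>n::nat. real_of_int (partition_G n) / real_of_int (partition_H n))
           \<sim>[at_top] (\<lambda>n. pi / sqrt (6 * real n))"
proof -
  define g where "g = (\<lambda>n::nat. pi / (12 * sqrt 2 * real n powr (3 / 2)) * exp (pi * sqrt (2 * real n / 3)))"
  define h where "h = (\<lambda>n::nat. exp (pi * sqrt (2 * real n / 3)) / (4 * sqrt 3 * real n))"
  \<comment> \<open>Allows passing from \<open>asymp_equiv\<close> to limits of quotients, since
    \<open>asymp_equiv\<close> counts a quotient 0/0 as 1.\<close>
  have nz: "\<forall>\<^sub>F n in sequentially. g n \<noteq> 0" "\<forall>\<^sub>F n in sequentially. h n \<noteq> 0"
    using eventually_gt_at_top[of 0] by (eventually_elim, simp add: g_def h_def)+
  have p: "(\<lambda>n. real (partition_number n)) \<sim>[at_top] h"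
    unfolding h_def by (rule hardy_ramanujan)
  \<comment> \<open>The two closed forms differ exactly by the factor \<open>pi / sqrt (6n)\<close>,
    so all three claims reduce to the asymptotics of \<open>p(n)\<close> and of its
    difference.\<close>
  have gh: "\<forall>\<^sub>F n in sequentially. pi / sqrt (6 * real n) * h n = g n"
    using eventually_gt_at_top[of 0]
  proof eventually_elim
    case (elim n)
    have "real n powr (3 / 2) = real n powr 1 * real n powr (1 / 2)" by (subst powr_add [symmetric]) simp
    hence p: "real n powr (3 / 2) = real n * sqrt (real n)" using elim by (simp add: powr_half_sqrt)
    have s: "sqrt (6 * real n) * sqrt 3 = 3 * (sqrt 2 * sqrt (real n))"
    proof -
      have "sqrt (6 * real n) * sqrt 3 = sqrt (3\<^sup>2 * (2 * real n))" by (simp flip: real_sqrt_mult)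
      also have "\<dots> = sqrt (3\<^sup>2) * sqrt (2 * real n)" by (rule real_sqrt_mult)
      also have "\<dots> = 3 * (sqrt 2 * sqrt (real n))" by (simp add: real_sqrt_mult)
      finally show ?thesis .
    qed
    have "pi / a * (R / (4 * b * real n)) = pi / (4 * (a * b) * real n) * R" for a b R :: real by simp
    hence "pi / sqrt (6 * real n) * h n = pi / (4 * (sqrt (6 * real n) * sqrt 3) * real n) * exp (pi * sqrt (2 * real n / 3))"
      unfolding h_def .
    thus ?case unfolding s g_def p by simp
  qed
  have g: "(\<lambda>n. real_of_int (partition_G n)) \<sim>[at_top] g"
  proof (rule asymp_equivI')
    have "(\<lambda>n. (real (partition_number (n + 1)) - real (partition_number n)) / g n) \<longlonglongrightarrow> 1"
    proof (rule asymp_equivD_strong)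
      show "(\<lambda>n. real (partition_number (n + 1)) - real (partition_number n)) \<sim>[at_top] g"
        unfolding g_def by (rule partition_number_difference_asymptotics)
      show "\<forall>\<^sub>F n in at_top. real (partition_number (n + 1)) - real (partition_number n) \<noteq> 0 \<or> g n \<noteq> 0"
        using nz(1) by eventually_elim simp
    qed
    \<comment> \<open>\<open>g\<close> outgrows every power of \<open>n\<close>, so the constant 2
      in \<open>G\<close> is negligible; in the same way \<open>h\<close> absorbs the summand
      \<open>n\<close> of \<open>H\<close> below.\<close>
    moreover have "(\<lambda>n. 2 / g n) \<longlonglongrightarrow> 0" unfolding g_def by real_asymp
    ultimately have "(\<lambda>n. (real (partition_number (n + 1)) - real (partition_number n)) / g n - 2 / g n) \<longlonglongrightarrow> 1 - 0"
      by (rule tendsto_diff)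
    thus "(\<lambda>n. real_of_int (partition_G n) / g n) \<longlonglongrightarrow> 1"
      by (simp add: partition_G_eq diff_divide_distrib)
  qed
  have H: "(\<lambda>n. real_of_int (partition_H n)) \<sim>[at_top] h"
  proof (rule asymp_equivI')
    have "(\<lambda>n. real (partition_number n) / h n) \<longlonglongrightarrow> 1"
    proof (rule asymp_equivD_strong[OF p])
      show "\<forall>\<^sub>F n in at_top. real (partition_number n) \<noteq> 0 \<or> h n \<noteq> 0"
        using nz(2) by eventually_elim simp
    qed
    moreover have "(\<lambda>n. real n / h n) \<longlonglongrightarrow> 0" unfolding h_def by real_asymp
    ultimately have "(\<lambda>n. real (partition_number n) / h n - real n / h n) \<longlonglongrightarrow> 1 - 0"
      by (rule tendsto_diff)
    thus "(\<lambda>n. real_of_int (partition_H n) / h n) \<longlonglongrightarrow> 1"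
      by (simp add: partition_H_def diff_divide_distrib)
  qed
  have "(\<lambda>n. pi / sqrt (6 * real n) * real (partition_number n)) \<sim>[at_top] (\<lambda>n. pi / sqrt (6 * real n) * h n)"
    by (intro asymp_equiv_mult p asymp_equiv_refl)
  also have "\<dots> \<sim>[at_top] g" using gh by (rule asymp_equiv_refl_ev)
  finally have "(\<lambda>n. pi / sqrt (6 * real n) * real (partition_number n)) \<sim>[at_top] g" .
  from asymp_equiv_trans[OF g asymp_equiv_symI[OF this]]
  have "(\<lambda>n. real_of_int (partition_G n)) \<sim>[at_top] (\<lambda>n. pi / sqrt (6 * real n) * real (partition_number n))" .
  moreover have "(\<lambda>n. real_of_int (partition_G n) / real_of_int (partition_H n)) \<sim>[at_top] (\<lambda>n. g n / h n)"
    by (intro asymp_equiv_divide g H)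
  hence "(\<lambda>n. real_of_int (partition_G n) / real_of_int (partition_H n)) \<sim>[at_top] (\<lambda>n. pi / sqrt (6 * real n))"
  proof (rule asymp_equiv_trans)
    show "(\<lambda>n. g n / h n) \<sim>[at_top] (\<lambda>n. pi / sqrt (6 * real n))"
    proof (rule asymp_equiv_refl_ev)
      show "\<forall>\<^sub>F n in sequentially. g n / h n = pi / sqrt (6 * real n)"
        using gh nz(2) by eventually_elim (simp add: field_simps)
    qed
  qed
  ultimately show ?thesis using g unfolding g_def by blast
qed

end
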